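(* Let $\ell\ge1$ be an integer. Every signed graph cospectral with the friendship graph $F_\ell$ is switching isomorphic to $F_\ell$, or disconnected.
   Context: A signed graph $G^\sigma$ is a finite simple graph $G=(V,E)$ with a function $\sigma:E\to\{-1,+1\}$. Its adjacency matrix has entry $\sigma(uv)$ at position $(u,v)$ when $uv\in E$, and $0$ otherwise; its spectrum is the spectrum (with multiplicities) of this matrix. Unsigned graphs are regarded as signed graphs with all edges positive. Switching with respect to $X\subseteq V$ changes the sign of all edges between $X$ and $V\setminus X$. Two signed graphs are switching isomorphic if one can be switched into an isomorphic copy of the other, and cospectral if they have the same spectrum. A signed graph is disconnected if its underlying graph $G$ is disconnected. The friendship graph $F_\ell$ is the unsigned graph on $2\ell+1$ vertices consisting of $\ell$ edge-disjoint triangles that all meet in one common vertex. *)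

theory Defs
  imports "Jordan_Normal_Form.Char_Poly" "HOL-Computational_Algebra.Polynomial"
    "HOL-Combinatorics.List_Permutation"
begin

section \<open>Signed graphs\<close>

text \<open>An edge is its two-element set of endpoints. The values of the field \<open>esign\<close> outside the
  edge set carry no meaning.\<close>

record 'a sgraph =
  verts :: "'a set"
  edges :: "'a set set"
  esign :: "'a set \<Rightarrow> int"

locale signed_graph =
  fixes G :: "'a sgraph"
  assumes finite_verts: "finite (verts G)"
    and edges_subset: "\<And>e. e \<in> edges G \<Longrightarrow> e \<subseteq> verts G"
    and card_edge: "\<And>e. e \<in> edges G \<Longrightarrow> card e = 2"
    and esign_edge: "\<And>e. e \<in> edges G \<Longrightarrow> esign G e \<in> {-1, 1}"

definition disconnected :: "'a sgraph \<Rightarrow> bool" where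
  "disconnected G \<longleftrightarrow>
     (\<exists>u\<in>verts G. \<exists>v\<in>verts G. (u, v) \<notin> {(x, y). {x, y} \<in> edges G}\<^sup>*)"

definition switch :: "'a set \<Rightarrow> 'a sgraph \<Rightarrow> 'a sgraph" where
  "switch X G =
     G\<lparr>esign := (\<lambda>e. if e \<inter> X \<noteq> {} \<and> e - X \<noteq> {} then - esign G e else esign G e)\<rparr>"

definition sgraph_isomorphic :: "'a sgraph \<Rightarrow> 'b sgraph \<Rightarrow> bool" where
  "sgraph_isomorphic G H \<longleftrightarrow>
     (\<exists>f. bij_betw f (verts G) (verts H) \<and>
        (\<forall>u\<in>verts G. \<forall>v\<in>verts G.
           ({u, v} \<in> edges G \<longleftrightarrow> {f u, f v} \<in> edges H) \<and>
           ({u, v} \<in> edges G \<longrightarrow> esign H {f u, f v} = esign G {u, v})))"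

definition switching_isomorphic :: "'a sgraph \<Rightarrow> 'b sgraph \<Rightarrow> bool" where
  "switching_isomorphic G H \<longleftrightarrow> (\<exists>X. X \<subseteq> verts G \<and> sgraph_isomorphic (switch X G) H)"


section \<open>Adjacency matrix and spectrum\<close>

text \<open>Rows and columns of a matrix are numbered, so the adjacency matrix is taken with respect to
  an enumeration \<open>vs\<close> of the vertices. It is a complex matrix in order that its characteristic
  polynomial splits and \<open>proots\<close> yields all eigenvalues, with multiplicities.\<close>

definition adj_matrix :: "'a sgraph \<Rightarrow> 'a list \<Rightarrow> complex mat" where
  "adj_matrix G vs = mat (length vs) (length vs)
     (\<lambda>(i, j). if {vs ! i, vs ! j} \<in> edges G then of_int (esign G {vs ! i, vs ! j}) else 0)"

definition sgraph_spectrum :: "'a sgraph \<Rightarrow> complex multiset" where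
  "sgraph_spectrum G =
     proots (char_poly (adj_matrix G (SOME vs. distinct vs \<and> set vs = verts G)))"

definition cospectral :: "'a sgraph \<Rightarrow> 'b sgraph \<Rightarrow> bool" where
  "cospectral G H \<longleftrightarrow> sgraph_spectrum G = sgraph_spectrum H"

lemma det_permute_rows_cols:
  fixes A :: "'a :: comm_ring_1 mat"
  assumes A: "A \<in> carrier_mat n n" and p: "p permutes {0..<n}"
  shows "det (mat n n (\<lambda>(i, j). A $$ (p i, p j))) = det A"
proof -
  have lt: "p i < n" if "i < n" for i
    using permutes_in_image[OF p, of i] that by simp
  define B where "B = mat n n (\<lambda>(i, j). A $$ (i, p j))"
  have B: "B \<in> carrier_mat n n" by (simp add: B_def)
  have "mat n n (\<lambda>(i, j). A $$ (p i, p j)) = mat n n (\<lambda>(i, j). B $$ (p i, j))"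
    by (rule eq_matI) (auto simp: B_def lt)
  then have 1: "det (mat n n (\<lambda>(i, j). A $$ (p i, p j))) = signof p * det B"
    using det_permute_rows[OF B p] by simp
  have "transpose_mat B = mat n n (\<lambda>(i, j). transpose_mat A $$ (p i, j))"
    using A by (intro eq_matI) (auto simp: B_def lt)
  then have "det B = signof p * det A"
    using det_permute_rows[OF transpose_carrier_mat[THEN iffD2, OF A] p]
      det_transpose[OF A] det_transpose[OF B] by simp
  then show ?thesis unfolding 1 by (simp add: sign_def)
qed

text \<open>The spectrum does not depend on the enumeration.\<close>

lemma sgraph_spectrum_eq:
  assumes "distinct vs" "set vs = verts G"
  shows "sgraph_spectrum G = proots (char_poly (adj_matrix G vs))"
proof -
  define ws where "ws = (SOME vs. distinct vs \<and> set vs = verts G)"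
  define n where "n = length vs"
  have ws: "distinct ws \<and> set ws = verts G"
    unfolding ws_def by (rule someI[of _ vs]) (use assms in auto)
  then have "mset ws = mset vs"
    using assms by (simp add: set_eq_iff_mset_eq_distinct[symmetric])
  then obtain p where p: "p permutes {..<length vs}" "permute_list p vs = ws"
    by (rule mset_eq_permutation)
  have p': "p permutes {0..<n}" using p(1) by (simp add: n_def lessThan_atLeast0)
  have lt: "p i < n" if "i < n" for i
    using permutes_in_image[OF p', of i] that by simp
  have inj: "p i = p j \<longleftrightarrow> i = j" for i j
    using permutes_inj[OF p'] by (auto dest: injD)
  have len: "length ws = n" using p(2) by (auto simp: n_def)
  have nth: "ws ! i = vs ! p i" if "i < n" for i
    using permute_list_nth[OF p(1), of i] p(2) that by (simp add: n_def)
  have "char_poly_matrix (adj_matrix G ws) =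
      mat n n (\<lambda>(i, j). char_poly_matrix (adj_matrix G vs) $$ (p i, p j))"
    by (rule eq_matI)
      (auto simp: char_poly_matrix_def adj_matrix_def len n_def[symmetric] nth lt inj)
  moreover have "char_poly_matrix (adj_matrix G vs) \<in> carrier_mat n n"
    by (simp add: char_poly_matrix_def adj_matrix_def n_def)
  ultimately have "char_poly (adj_matrix G ws) = char_poly (adj_matrix G vs)"
    unfolding char_poly_def using det_permute_rows_cols[OF _ p'] by metis
  then show ?thesis by (simp add: sgraph_spectrum_def ws_def)
qed


section \<open>Friendship graphs\<close>

text \<open>The vertex 0 is the common vertex of the triangles \<open>{0, 2 * i + 1, 2 * i + 2}\<close> for \<open>i < l\<close>.\<close>

definition friendship_graph :: "nat \<Rightarrow> nat sgraph" where
  "friendship_graph l =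
     \<lparr>verts = {0..2 * l},
      edges = (\<Union>i<l. {{0, 2 * i + 1}, {0, 2 * i + 2}, {2 * i + 1, 2 * i + 2}}),
      esign = (\<lambda>_. 1)\<rparr>"

lemma signed_graph_friendship_graph: "signed_graph (friendship_graph l)"
  by unfold_locales (auto simp: friendship_graph_def)

end

theory Submission
  imports Defs "Jordan_Normal_Form.Schur_Decomposition"
begin

text \<open>Write \<open>A\<close> for the signed adjacency matrix of \<open>G\<close> and \<open>B = A\<^sup>2 - I\<close>.
Apart from \<open>1\<close> and \<open>-1\<close>, the only eigenvalues of the friendship graph are the two
roots \<open>r, s\<close> of \<open>x\<^sup>2 - x - 2 l\<close>, which are simple unless \<open>l = 1\<close>
and \<open>s = -1\<close>. Hence for a cospectral \<open>G\<close> the matrix \<open>B\<close> is an integral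
positive semidefinite matrix of rank at most two, with trace \<open>4 l - 1\<close>, and \<open>A\<close> acts
on its image with eigenvalues among \<open>r, s\<close>. These facts are obtained from equality of all traces
\<open>tr p(A)\<close>, which determines enough of \<open>A\<close> without any eigenvectors: a real symmetric
matrix \<open>M\<close> with \<open>tr M\<^sup>2 = 0\<close> is zero, so a polynomial that annihilates one of
two cospectral symmetric matrices annihilates the other (\<open>poly_at_eq_0_if_trace_sq_eq_0\<close>), and a
symmetric \<open>R\<close> with \<open>R\<^sup>2 = b R\<close> and \<open>tr R = b\<close> has rank at most one
(\<open>rank_one_if_trace_eq\<close>).

Since \<open>B\<close> is a Gram matrix of vectors in the plane with integral inner products, and its diagonal
entry at a vertex is the degree minus one, connectedness excludes the degrees 0 and 1, and the trace leaves at
least three vertices of degree two (\<open>card_U_ge_3\<close>), which carry unit vectors. Two orthogonal unit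
vectors are impossible by a parity argument, so all unit vectors agree up to sign (\<open>units_row\<close>),
and any two vertices of degree two have exactly one common neighbour (\<open>units_common_nb\<close>). The rest
is counting.

If two vertices of degree two are adjacent, they form a triangle with a vertex \<open>q\<close>. If this
triangle is positive, the trace of what remains of \<open>B\<close> after splitting off the unit direction
forces every vertex other than \<open>q\<close> to have degree two and to lie in a positive triangle with
\<open>q\<close>; if it is negative, \<open>G\<close> is disconnected
(\<open>adjacent_units_imp_friendship\<close>). If no two of them are adjacent, then there are exactly three
(\<open>card_U_eq_3\<close>), all remaining vertices have degree three, and this is contradictory
(\<open>no_adjacent_units_False\<close>). Switching at the neighbours joined to \<open>q\<close> by a negative
edge finally makes all edges positive.\<close>

section \<open>Traces of matrix powers\<close>

lemma sum_diag_mult_commute: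
  fixes X Y :: "'a :: comm_semiring_0 mat"
  assumes "X \<in> carrier_mat n n" "Y \<in> carrier_mat n n"
  shows "(\<Sum>i<n. (X * Y) $$ (i, i)) = (\<Sum>i<n. (Y * X) $$ (i, i))"
proof -
  have *: "(\<Sum>i<n. (P * Q) $$ (i, i)) = (\<Sum>i<n. \<Sum>j<n. P $$ (i, j) * Q $$ (j, i))"
    if "P \<in> carrier_mat n n" "Q \<in> carrier_mat n n" for P Q :: "'a mat"
    using that by (intro sum.cong refl) (auto simp: scalar_prod_def atLeast0LessThan)
  show ?thesis
    unfolding *[OF assms] *[OF assms(2,1)] by (subst sum.swap) (simp add: mult.commute)
qed

lemma upper_triangular_pow:
  fixes T :: "'a :: comm_semiring_1 mat"
  assumes T: "T \<in> carrier_mat n n" "upper_triangular T"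
  shows "(\<forall>i<n. \<forall>j<i. (T ^\<^sub>m k) $$ (i, j) = 0) \<and> (\<forall>i<n. (T ^\<^sub>m k) $$ (i, i) = (T $$ (i, i)) ^ k)"
proof (induction k)
  case 0
  show ?case using T by auto
next
  case (Suc k)
  have c: "T ^\<^sub>m k \<in> carrier_mat n n" using T by simp
  have mult: "(T ^\<^sub>m Suc k) $$ (i, j) = (\<Sum>m<n. (T ^\<^sub>m k) $$ (i, m) * T $$ (m, j))"
    if "i < n" "j < n" for i j
    using T c that by (auto simp: scalar_prod_def atLeast0LessThan)
  have low: "T $$ (i, j) = 0" if "j < i" "i < n" for i j
    using T that by auto
  have "(T ^\<^sub>m Suc k) $$ (i, j) = 0" if "j < i" "i < n" for i j
  proof -
    have "(T ^\<^sub>m k) $$ (i, m) * T $$ (m, j) = 0" if "m < n" for m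
      using Suc.IH low[of j m] \<open>j < i\<close> \<open>i < n\<close> that by (cases "m < i") auto
    then show ?thesis using mult[of i j] that by simp
  qed
  moreover have "(T ^\<^sub>m Suc k) $$ (i, i) = (T $$ (i, i)) ^ Suc k" if i: "i < n" for i
  proof -
    have "(T ^\<^sub>m k) $$ (i, m) * T $$ (m, i) = (if m = i then (T $$ (i, i)) ^ Suc k else 0)" if "m < n" for m
      using Suc.IH low[of i m] i that by (cases m i rule: linorder_cases) (auto simp: mult.commute)
    then show ?thesis using mult[of i i] i by simp
  qed
  ultimately show ?case by blast
qed

text \<open>Schur triangularisation preserves the trace of every power, and the diagonal of a triangular form lists the
eigenvalues.\<close>

lemma sum_diag_pow_eq_power_sum:
  fixes M :: "complex mat"
  assumes M: "M \<in> carrier_mat n n"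
  shows "(\<Sum>i<n. (M ^\<^sub>m k) $$ (i, i)) = (\<Sum>x\<in>#proots (char_poly M). x ^ k)"
proof -
  obtain es where es: "mset es = proots (char_poly M)"
    using ex_mset by blast
  have "char_poly M = (\<Prod>x\<in>#proots (char_poly M). [:- x, 1:])"
    using complex_poly_decompose_multiset[of "char_poly M"] degree_monic_char_poly[OF M] by simp
  then have c: "char_poly M = (\<Prod>e\<leftarrow>es. [:- e, 1:])"
    unfolding es[symmetric] by (metis mset_map prod_mset_prod_list)
  obtain T P Q where "schur_decomposition M es = (T, P, Q)"
    by (metis prod_cases3)
  from schur_decomposition[OF M c this] have
    w: "similar_mat_wit M T P Q" and T: "upper_triangular T" "diag_mat T = es" by auto
  note d = similar_mat_witD2[OF M w]
  have Tk: "T ^\<^sub>m k \<in> carrier_mat n n" using d by simp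
  have "(\<Sum>i<n. (M ^\<^sub>m k) $$ (i, i)) = (\<Sum>i<n. (P * (T ^\<^sub>m k * Q)) $$ (i, i))"
    using similar_mat_wit_pow_id[OF w, of k] assoc_mult_mat[OF d(6) Tk d(7)] by simp
  also have "\<dots> = (\<Sum>i<n. (T ^\<^sub>m k * Q * P) $$ (i, i))"
    using d Tk by (intro sum_diag_mult_commute) auto
  also have "T ^\<^sub>m k * Q * P = T ^\<^sub>m k"
    using assoc_mult_mat[OF Tk d(7) d(6)] d(2) right_mult_one_mat[OF Tk] by simp
  also have "(\<Sum>i<n. (T ^\<^sub>m k) $$ (i, i)) = (\<Sum>i<n. (T $$ (i, i)) ^ k)"
    using upper_triangular_pow[OF d(5) T(1), of k] by simp
  also have "\<dots> = (\<Sum>e\<leftarrow>es. e ^ k)"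
    using d(5) unfolding T(2)[symmetric] diag_mat_def
    by (simp add: sum_list_sum_nth atLeast0LessThan comp_def)
  also have "\<dots> = (\<Sum>x\<in>#proots (char_poly M). x ^ k)"
    unfolding es[symmetric] by (metis mset_map sum_mset_sum_list)
  finally show ?thesis .
qed

section \<open>Polynomials in a symmetric matrix\<close>

text \<open>Matrices are functions on pairs of vertices, multiplied by summation over \<open>V\<close>. This avoids an
enumeration of the vertices; \<open>V\<close> is finite in every use.\<close>

primrec mat_power :: "'a set \<Rightarrow> ('a \<Rightarrow> 'a \<Rightarrow> 'b) \<Rightarrow> nat \<Rightarrow> 'a \<Rightarrow> 'a \<Rightarrow> 'b :: comm_ring_1" where
  "mat_power V A 0 u v = of_bool (u = v)"
| "mat_power V A (Suc k) u v = (\<Sum>w\<in>V. A u w * mat_power V A k w v)"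

text \<open>The value \<open>p(A)\<close> of a polynomial at a matrix. All matrices below are polynomials in
\<open>A\<close>, so that identities between them reduce to identities between polynomials.\<close>

definition poly_at :: "'a set \<Rightarrow> ('a \<Rightarrow> 'a \<Rightarrow> 'b) \<Rightarrow> 'b poly \<Rightarrow> 'a \<Rightarrow> 'a \<Rightarrow> 'b :: comm_ring_1" where
  "poly_at V A p u v = (\<Sum>k\<le>degree p. coeff p k * mat_power V A k u v)"

lemma poly_at_altdef:
  assumes "degree p \<le> N"
  shows "poly_at V A p u v = (\<Sum>k\<le>N. coeff p k * mat_power V A k u v)"
  unfolding poly_at_def
  by (rule sum.mono_neutral_left) (use assms in \<open>auto simp: coeff_eq_0\<close>)

lemma poly_at_0 [simp]: "poly_at V A 0 u v = 0"
  by (simp add: poly_at_def)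

lemma poly_at_add: "poly_at V A (p + q) u v = poly_at V A p u v + poly_at V A q u v"
proof -
  let ?N = "max (degree p) (degree q)"
  show ?thesis
    using poly_at_altdef[of p ?N V A u v] poly_at_altdef[of q ?N V A u v]
      poly_at_altdef[of "p + q" ?N V A u v] degree_add_le_max[of p q]
    by (simp add: sum.distrib distrib_right)
qed

lemma poly_at_smult: "poly_at V A (Polynomial.smult c p) u v = c * poly_at V A p u v"
  unfolding poly_at_altdef[OF degree_smult_le] unfolding poly_at_def
  by (simp add: sum_distrib_left mult.assoc)

lemma poly_at_diff: "poly_at V A (p - q) u v = poly_at V A p u v - poly_at V A q u v"
proof -
  have "p - q = p + Polynomial.smult (-1) q" by simp
  then show ?thesis by (simp only: poly_at_add poly_at_smult) simp
qed

lemma poly_at_pCons: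
  "poly_at V A (pCons c p) u v = c * of_bool (u = v) + (\<Sum>w\<in>V. A u w * poly_at V A p w v)"
proof -
  have "poly_at V A (pCons c p) u v =
      (\<Sum>k\<le>Suc (degree p). coeff (pCons c p) k * mat_power V A k u v)"
    by (rule poly_at_altdef) (rule degree_pCons_le)
  also have "\<dots> = c * of_bool (u = v)
      + (\<Sum>k\<le>degree p. coeff p k * (\<Sum>w\<in>V. A u w * mat_power V A k w v))"
    by (subst sum.atMost_Suc_shift) (simp add: coeff_pCons)
  also have "(\<Sum>k\<le>degree p. coeff p k * (\<Sum>w\<in>V. A u w * mat_power V A k w v)) =
      (\<Sum>w\<in>V. A u w * poly_at V A p w v)"
    unfolding poly_at_def sum_distrib_left by (subst sum.swap) (simp add: mult_ac)
  finally show ?thesis .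
qed

lemma poly_at_mult:
  assumes "finite V" "u \<in> V"
  shows "poly_at V A (p * q) u v = (\<Sum>w\<in>V. poly_at V A p u w * poly_at V A q w v)"
  using assms(2)
proof (induction p arbitrary: u)
  case (pCons c p)
  have "(\<Sum>w\<in>V. poly_at V A (pCons c p) u w * poly_at V A q w v) =
      (\<Sum>w\<in>V. (if u = w then c * poly_at V A q w v else 0)) +
      (\<Sum>w\<in>V. \<Sum>x\<in>V. A u x * poly_at V A p x w * poly_at V A q w v)"
    unfolding poly_at_pCons sum.distrib[symmetric]
    by (intro sum.cong refl) (auto simp: algebra_simps sum_distrib_left)
  also have "(\<Sum>w\<in>V. (if u = w then c * poly_at V A q w v else 0)) = c * poly_at V A q u v"
    using assms(1) pCons.prems by simp
  also have "(\<Sum>w\<in>V. \<Sum>x\<in>V. A u x * poly_at V A p x w * poly_at V A q w v) =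
      (\<Sum>x\<in>V. A u x * poly_at V A (p * q) x v)"
    by (subst sum.swap) (simp add: pCons.IH sum_distrib_left mult.assoc)
  also have "c * poly_at V A q u v + \<dots> = poly_at V A (pCons c p * q) u v"
    by (simp add: poly_at_add poly_at_smult poly_at_pCons)
  finally show ?case ..
qed simp

lemma poly_at_sym:
  assumes "finite V" and sym: "\<And>u v. u \<in> V \<Longrightarrow> v \<in> V \<Longrightarrow> A u v = A v u"
    and "u \<in> V" "v \<in> V"
  shows "poly_at V A p u v = poly_at V A p v u"
  using assms(3,4)
proof (induction p arbitrary: u v)
  case (pCons c p)
  have X: "poly_at V A [:0, 1:] u w = A u w" if "w \<in> V" for u w
    using assms(1) that by (simp add: poly_at_pCons if_distrib cong: if_cong)
  have "(\<Sum>w\<in>V. A u w * poly_at V A p w v) = poly_at V A ([:0, 1:] * p) u v"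
    using assms(1) pCons.prems by (subst poly_at_mult) (simp_all add: X)
  also have "\<dots> = (\<Sum>w\<in>V. poly_at V A p u w * A w v)"
    using assms(1) pCons.prems by (subst mult.commute, subst poly_at_mult) (simp_all add: X)
  also have "\<dots> = (\<Sum>w\<in>V. A v w * poly_at V A p w u)"
    using pCons.prems by (intro sum.cong refl) (simp add: pCons.IH sym mult.commute)
  finally show ?case by (simp add: poly_at_pCons eq_commute[of u v])
qed simp

definition trace_at :: "'a set \<Rightarrow> ('a \<Rightarrow> 'a \<Rightarrow> 'b) \<Rightarrow> 'b poly \<Rightarrow> 'b :: comm_ring_1" where
  "trace_at V A p = (\<Sum>u\<in>V. poly_at V A p u u)"

lemma trace_at_power_sums:
  "trace_at V A p = (\<Sum>k\<le>degree p. coeff p k * (\<Sum>u\<in>V. mat_power V A k u u))"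
  unfolding trace_at_def poly_at_def by (subst sum.swap) (simp add: sum_distrib_left)

lemma poly_at_X:
  assumes "finite V" "v \<in> V"
  shows "poly_at V A [:0, 1:] u v = A u v"
  using assms by (simp add: poly_at_pCons if_distrib cong: if_cong)

lemma poly_at_mult_X:
  assumes "finite V" "u \<in> V" "v \<in> V"
  shows "poly_at V A (p * [:0, 1:]) u v = (\<Sum>w\<in>V. poly_at V A p u w * A w v)"
  using assms by (simp add: poly_at_mult poly_at_X del: mult_pCons_right)

lemma poly_at_sq_minus_1:
  assumes "finite V" "v \<in> V"
  shows "poly_at V A [:-1, 0, 1:] u v = (\<Sum>w\<in>V. A u w * A w v) - of_bool (u = v)"
  using assms poly_at_X[OF assms] by (simp add: poly_at_pCons)

section \<open>Adjacency matrices of cospectral graphs\<close>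

definition sadj :: "'a sgraph \<Rightarrow> 'a \<Rightarrow> 'a \<Rightarrow> int" where
  "sadj G u v = (if {u, v} \<in> edges G then esign G {u, v} else 0)"

lemma sadj_sym: "sadj G u v = sadj G v u"
  by (simp add: sadj_def insert_commute)

lemma adj_matrix_power:
  assumes "distinct vs" "set vs = verts G" "i < length vs" "j < length vs"
  shows "(adj_matrix G vs ^\<^sub>m k) $$ (i, j) =
    complex_of_real (mat_power (verts G) (\<lambda>u v. of_int (sadj G u v)) k (vs ! i) (vs ! j))"
  using assms(3,4)
proof (induction k arbitrary: i j)
  case 0
  then show ?case using assms(1) by (auto simp: adj_matrix_def nth_eq_iff_index_eq)
next
  case (Suc k)
  let ?M = "adj_matrix G vs" and ?n = "length vs"
  let ?w = "mat_power (verts G) (\<lambda>u v. real_of_int (sadj G u v)) k"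
  have c: "?M \<in> carrier_mat ?n ?n" by (simp add: adj_matrix_def)
  then have ck: "?M ^\<^sub>m k \<in> carrier_mat ?n ?n" by simp
  have "?M ^\<^sub>m Suc k = ?M * ?M ^\<^sub>m k"
    using c by (induction k) (auto, metis assoc_mult_mat pow_carrier_mat)
  then have "(?M ^\<^sub>m Suc k) $$ (i, j) = (\<Sum>m<?n. ?M $$ (i, m) * (?M ^\<^sub>m k) $$ (m, j))"
    using c ck Suc.prems by (auto simp: scalar_prod_def atLeast0LessThan)
  also have "\<dots> = (\<Sum>m<?n. complex_of_real (of_int (sadj G (vs ! i) (vs ! m)) * ?w (vs ! m) (vs ! j)))"
    using Suc by (intro sum.cong refl) (auto simp: adj_matrix_def sadj_def)
  also have "\<dots> = complex_of_real (\<Sum>m<?n. of_int (sadj G (vs ! i) (vs ! m)) * ?w (vs ! m) (vs ! j))"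
    by simp
  also have "(\<Sum>m<?n. of_int (sadj G (vs ! i) (vs ! m)) * ?w (vs ! m) (vs ! j)) =
      (\<Sum>u\<in>verts G. of_int (sadj G (vs ! i) u) * ?w u (vs ! j))"
    by (rule sum.reindex_bij_betw)
      (use assms(1,2) bij_betw_nth[of vs "{..<?n}" "verts G"] in auto)
  finally show ?case by simp
qed

text \<open>This is the only consequence of cospectrality that the proof uses.\<close>

lemma cospectral_trace_at:
  assumes "cospectral G H" "finite (verts G)" "finite (verts H)"
  shows "trace_at (verts G) (\<lambda>u v. real_of_int (sadj G u v)) p =
    trace_at (verts H) (\<lambda>u v. real_of_int (sadj H u v)) p"
proof -
  have *: "complex_of_real (\<Sum>u\<in>verts K. mat_power (verts K) (\<lambda>u v. of_int (sadj K u v)) k u u) =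
      (\<Sum>x\<in>#sgraph_spectrum K. x ^ k)" if fin: "finite (verts K)" for K :: "'c sgraph" and k
  proof -
    obtain vs where vs: "distinct vs" "set vs = verts K"
      using finite_distinct_list[OF fin] by auto
    have c: "adj_matrix K vs \<in> carrier_mat (length vs) (length vs)"
      by (simp add: adj_matrix_def)
    let ?f = "\<lambda>u. complex_of_real (mat_power (verts K) (\<lambda>u v. of_int (sadj K u v)) k u u)"
    have "(\<Sum>u\<in>verts K. ?f u) = (\<Sum>i<length vs. ?f (vs ! i))"
      by (rule sum.reindex_bij_betw[symmetric])
        (use vs bij_betw_nth[of vs "{..<length vs}" "verts K"] in auto)
    also have "\<dots> = (\<Sum>i<length vs. (adj_matrix K vs ^\<^sub>m k) $$ (i, i))"
      using vs by (intro sum.cong refl) (simp add: adj_matrix_power)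
    finally show ?thesis
      using sum_diag_pow_eq_power_sum[OF c, of k] sgraph_spectrum_eq[OF vs] by simp
  qed
  have "sgraph_spectrum G = sgraph_spectrum H"
    using assms(1) by (simp add: cospectral_def)
  then show ?thesis
    unfolding trace_at_power_sums using *[OF assms(2)] *[OF assms(3)] of_real_eq_iff[where 'a=complex]
    by (intro sum.cong refl arg_cong2[where f="(*)"]) metis
qed

section \<open>Rank from traces\<close>

text \<open>For symmetric \<open>M = p(A)\<close> the trace of \<open>M\<^sup>2\<close> is the sum of the squared entries of
\<open>M\<close>. The hypothesis only concerns a trace, so it passes between cospectral matrices.\<close>

lemma poly_at_eq_0_if_trace_sq_eq_0:
  fixes A :: "'a \<Rightarrow> 'a \<Rightarrow> real"
  assumes fin: "finite V" and sym: "\<And>u v. u \<in> V \<Longrightarrow> v \<in> V \<Longrightarrow> A u v = A v u"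
    and tr: "trace_at V A (p * p) = 0" and uv: "u \<in> V" "v \<in> V"
  shows "poly_at V A p u v = 0"
proof -
  have "trace_at V A (p * p) = (\<Sum>x\<in>V. \<Sum>y\<in>V. (poly_at V A p x y)\<^sup>2)"
    unfolding trace_at_def
  proof (intro sum.cong refl)
    fix x assume x: "x \<in> V"
    have "poly_at V A (p * p) x x = (\<Sum>y\<in>V. poly_at V A p x y * poly_at V A p y x)"
      by (rule poly_at_mult[OF fin x])
    also have "\<dots> = (\<Sum>y\<in>V. (poly_at V A p x y)\<^sup>2)"
    proof (intro sum.cong refl)
      fix y assume y: "y \<in> V"
      have "poly_at V A p y x = poly_at V A p x y" using fin sym y x by (rule poly_at_sym)
      then show "poly_at V A p x y * poly_at V A p y x = (poly_at V A p x y)\<^sup>2"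
        by (simp add: power2_eq_square)
    qed
    finally show "poly_at V A (p * p) x x = (\<Sum>y\<in>V. (poly_at V A p x y)\<^sup>2)" .
  qed
  then have "\<forall>x\<in>V. \<forall>y\<in>V. (poly_at V A p x y)\<^sup>2 = 0"
    using tr fin by (simp add: sum_nonneg_eq_0_iff sum_nonneg)
  then show ?thesis using uv by simp
qed

text \<open>If \<open>b > 0\<close>, all 2-by-2 principal minors of \<open>R\<close> are nonnegative, because \<open>b
R\<close> is the Gram matrix of the rows of \<open>R\<close>. Their sum over all pairs is \<open>(tr R)\<^sup>2
- tr R\<^sup>2 = b\<^sup>2 - b\<^sup>2 = 0\<close>, so each of them vanishes and all rows are proportional.\<close>

lemma rank_one_if_trace_eq:
  fixes R :: "'a \<Rightarrow> 'a \<Rightarrow> real"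
  assumes fin: "finite V" and sym: "\<And>u v. u \<in> V \<Longrightarrow> v \<in> V \<Longrightarrow> R u v = R v u"
    and sq: "\<And>u v. u \<in> V \<Longrightarrow> v \<in> V \<Longrightarrow> (\<Sum>w\<in>V. R u w * R w v) = b * R u v"
    and tr: "(\<Sum>u\<in>V. R u u) = b" and b: "b \<ge> 0"
  shows "\<exists>g. \<forall>u\<in>V. \<forall>v\<in>V. R u v = g u * g v"
proof (cases "b = 0")
  case True
  have "R u v = 0" if "u \<in> V" "v \<in> V" for u v
  proof -
    have "(\<Sum>w\<in>V. (R u w)\<^sup>2) = 0"
      using sq[OF that(1) that(1)] True sym that(1)
      by (simp add: power2_eq_square cong: sum.cong)
    then show ?thesis using that fin by (simp add: sum_nonneg_eq_0_iff)
  qed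
  then show ?thesis by (intro exI[of _ "\<lambda>_. 0"]) simp
next
  case False
  with b have b: "b > 0" by simp
  have prod: "(\<Sum>w\<in>V. R u w * R v w) = b * R u v" if "u \<in> V" "v \<in> V" for u v
    using sq[OF that] sym[OF that(2)] by (simp cong: sum.cong)
  have diag: "R u u \<ge> 0" if "u \<in> V" for u
  proof -
    have "(\<Sum>w\<in>V. R u w * R u w) \<ge> 0" by (simp add: sum_nonneg)
    then have "b * R u u \<ge> 0" using prod[OF that that] by simp
    then show ?thesis using b by (simp add: zero_le_mult_iff)
  qed
  \<comment> \<open>the left-hand side measures the failure of row \<open>v\<close> to be a multiple of row \<open>u\<close>\<close>
  have gap: "(\<Sum>w\<in>V. (R u u * R v w - R u v * R u w)\<^sup>2) = b * R u u * (R u u * R v v - (R u v)\<^sup>2)"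
    if "u \<in> V" "v \<in> V" for u v
  proof -
    have "(\<Sum>w\<in>V. (R u u * R v w - R u v * R u w)\<^sup>2) =
        (\<Sum>w\<in>V. (R u u)\<^sup>2 * (R v w * R v w) - 2 * R u u * R u v * (R u w * R v w)
          + (R u v)\<^sup>2 * (R u w * R u w))"
      by (intro sum.cong refl) (simp add: power2_eq_square algebra_simps)
    also have "\<dots> = (R u u)\<^sup>2 * (b * R v v) - 2 * R u u * R u v * (b * R u v) + (R u v)\<^sup>2 * (b * R u u)"
      by (simp only: sum.distrib sum_subtractf flip: sum_distrib_left) (simp add: prod that)
    finally show ?thesis by (simp add: power2_eq_square algebra_simps)
  qed
  have minor: "R u u * R v v - (R u v)\<^sup>2 \<ge> 0" if "u \<in> V" "v \<in> V" for u v
  proof (cases "R u u = 0")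
    case True
    have "(\<Sum>w\<in>V. (R u w)\<^sup>2) = 0" using prod[OF that(1,1)] True by (simp add: power2_eq_square)
    then show ?thesis using that fin True by (simp add: sum_nonneg_eq_0_iff)
  next
    case False
    then have "b * R u u > 0" using diag[OF that(1)] b by simp
    moreover have "b * R u u * (R u u * R v v - (R u v)\<^sup>2) \<ge> 0"
      unfolding gap[OF that, symmetric] by (simp add: sum_nonneg)
    ultimately show ?thesis by (simp add: zero_le_mult_iff)
  qed
  have "(\<Sum>u\<in>V. \<Sum>v\<in>V. R u u * R v v - (R u v)\<^sup>2) = 0"
    using prod by (simp add: sum_subtractf power2_eq_square tr flip: sum_distrib_left sum_distrib_right)
  then have minor0: "R u u * R v v - (R u v)\<^sup>2 = 0" if "u \<in> V" "v \<in> V" for u v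
    using that minor fin by (simp add: sum_nonneg_eq_0_iff sum_nonneg)
  obtain z where z: "z \<in> V" "R z z > 0"
    using tr b sum_nonpos[of V "\<lambda>u. R u u"] by force
  have "R z z * R v w = R z v * R z w" if "v \<in> V" "w \<in> V" for v w
  proof -
    have "(\<Sum>w\<in>V. (R z z * R v w - R z v * R z w)\<^sup>2) = 0"
      unfolding gap[OF z(1) that(1)] using minor0[OF z(1) that(1)] by simp
    then show ?thesis using that fin by (simp add: sum_nonneg_eq_0_iff)
  qed
  then have "R v w = (R z v / sqrt (R z z)) * (R z w / sqrt (R z z))" if "v \<in> V" "w \<in> V" for v w
    using that z(2) by (simp add: field_simps)
  then show ?thesis by (intro exI[of _ "\<lambda>v. R z v / sqrt (R z z)"]) blast
qed

text \<open>If \<open>r, s\<close> are the roots of \<open>x\<^sup>2 - x - m\<close>, then on the eigenspaces of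
\<open>A\<close> the matrix \<open>(A\<^sup>2 - I)(A - s)\<close> acts as \<open>(r\<^sup>2 - 1)(r - s)\<close>
for the eigenvalue \<open>r\<close> and as zero for the eigenvalues \<open>1, -1, s\<close>. After division by
\<open>r - s\<close> it satisfies \<open>R\<^sup>2 = (r\<^sup>2 - 1) R\<close>, and the two given traces say
that its trace is \<open>r\<^sup>2 - 1\<close>, that is, that \<open>r\<close> is simple when \<open>r\<^sup>2
\<noteq> 1\<close>.\<close>

lemma rank_one_component:
  fixes A :: "'a \<Rightarrow> 'a \<Rightarrow> real" and m r s :: real
  assumes fin: "finite V" and sym: "\<And>u v. u \<in> V \<Longrightarrow> v \<in> V \<Longrightarrow> A u v = A v u"
    and ann: "\<And>u v. u \<in> V \<Longrightarrow> v \<in> V \<Longrightarrow> poly_at V A ([:-1, 0, 1:] * [:-m, -1, 1:]) u v = 0"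
    and tr1: "trace_at V A [:-1, 0, 1:] = 2 * m - 1"
    and tr2: "trace_at V A ([:-1, 0, 1:] * [:0, 1:]) = 3 * m"
    and rs: "r + s = 1" "r * s = - m" "r \<noteq> s" and r: "r\<^sup>2 \<ge> 1"
  shows "\<exists>g. \<forall>u\<in>V. \<forall>v\<in>V. poly_at V A ([:-1, 0, 1:] * [:-s, 1:]) u v = (r - s) * (g u * g v)"
proof -
  define P where "P = [:-1, 0, 1:] * [:-s, 1:]"
  have s: "s = 1 - r" using rs(1) by simp
  have m: "m = r * r - r" using rs(2) unfolding s by (simp add: algebra_simps)
  \<comment> \<open>modulo the annihilating polynomial, \<open>P\<^sup>2\<close> is a multiple of \<open>P\<close>: the cofactor is the quotient of \<open>(x\<^sup>2 - 1)(x - s) - (r\<^sup>2 - 1)(r - s)\<close> by \<open>x - r\<close>\<close>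
  have PP: "P * P = Polynomial.smult ((r\<^sup>2 - 1) * (r - s)) P
      + [:-1, 0, 1:] * [:-m, -1, 1:] * [:r * r - s * r - 1, r - s, 1:]"
    unfolding P_def s m
    by (simp, intro conjI, simp_all add: power2_eq_square, simp_all only: algebra_simps)
  have P_sq: "(\<Sum>w\<in>V. poly_at V A P u w * poly_at V A P w v) = (r\<^sup>2 - 1) * (r - s) * poly_at V A P u v"
    if uv: "u \<in> V" "v \<in> V" for u v
  proof -
    let ?ann = "[:-1, 0, 1:] * [:-m, -1, 1:]"
    have "(\<Sum>w\<in>V. poly_at V A P u w * poly_at V A P w v) = poly_at V A (P * P) u v"
      by (rule poly_at_mult[OF fin uv(1), symmetric])
    also have "\<dots> = (r\<^sup>2 - 1) * (r - s) * poly_at V A P u v +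
        poly_at V A (?ann * [:r * r - s * r - 1, r - s, 1:]) u v"
      unfolding PP poly_at_add poly_at_smult ..
    also have "poly_at V A (?ann * [:r * r - s * r - 1, r - s, 1:]) u v =
        (\<Sum>w\<in>V. poly_at V A ?ann u w * poly_at V A [:r * r - s * r - 1, r - s, 1:] w v)"
      by (rule poly_at_mult[OF fin uv(1)])
    also have "\<dots> = (\<Sum>w\<in>V. 0)"
      by (intro sum.cong refl) (simp only: ann[OF uv(1)] mult_zero_left)
    finally show ?thesis by simp
  qed
  have P: "P = [:-1, 0, 1:] * [:0, 1:] - Polynomial.smult s [:-1, 0, 1:]"
    unfolding P_def by simp
  have P_tr: "(\<Sum>u\<in>V. poly_at V A P u u) = (r\<^sup>2 - 1) * (r - s)"
    unfolding P poly_at_diff poly_at_smult sum_subtractf sum_distrib_left[symmetric]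
      trace_at_def[symmetric] tr1 tr2
    unfolding s m by (simp add: algebra_simps power2_eq_square)
  have "\<exists>g. \<forall>u\<in>V. \<forall>v\<in>V. poly_at V A P u v / (r - s) = g u * g v"
  proof (rule rank_one_if_trace_eq[OF fin, where b = "r\<^sup>2 - 1"])
    fix u v assume uv: "u \<in> V" "v \<in> V"
    have "poly_at V A P u v = poly_at V A P v u"
      using fin sym uv by (rule poly_at_sym)
    then show "poly_at V A P u v / (r - s) = poly_at V A P v u / (r - s)"
      by simp
    show "(\<Sum>w\<in>V. poly_at V A P u w / (r - s) * (poly_at V A P w v / (r - s))) =
        (r\<^sup>2 - 1) * (poly_at V A P u v / (r - s))"
      using P_sq[OF uv] rs(3) by (simp add: sum_divide_distrib[symmetric])
  next
    show "(\<Sum>u\<in>V. poly_at V A P u u / (r - s)) = r\<^sup>2 - 1"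
      using P_tr rs(3) by (simp add: sum_divide_distrib[symmetric])
  qed (use r in simp)
  then show ?thesis using rs(3) unfolding P_def by (simp add: field_simps)
qed

text \<open>Here \<open>A\<^sup>2 - I\<close> is the sum of the rank-one components that belong to the two roots
\<open>r\<close> and \<open>s\<close>, and both are positive semidefinite because \<open>r\<^sup>2 \<ge>
1\<close> and \<open>s\<^sup>2 \<ge> 1\<close>.\<close>

lemma sq_minus_1_rank_two:
  fixes A :: "'a \<Rightarrow> 'a \<Rightarrow> real" and m :: real
  assumes fin: "finite V" and sym: "\<And>u v. u \<in> V \<Longrightarrow> v \<in> V \<Longrightarrow> A u v = A v u"
    and ann: "\<And>u v. u \<in> V \<Longrightarrow> v \<in> V \<Longrightarrow> poly_at V A ([:-1, 0, 1:] * [:-m, -1, 1:]) u v = 0"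
    and tr1: "trace_at V A [:-1, 0, 1:] = 2 * m - 1"
    and tr2: "trace_at V A ([:-1, 0, 1:] * [:0, 1:]) = 3 * m"
    and m: "m \<ge> 2"
  shows "\<exists>f g. \<forall>u\<in>V. \<forall>v\<in>V. poly_at V A [:-1, 0, 1:] u v = f u * f v + g u * g v"
proof -
  \<comment> \<open>the square root of the discriminant of \<open>x\<^sup>2 - x - m\<close>\<close>
  define d where "d = sqrt (1 + 4 * m)"
  define r where "r = (1 + d) / 2"
  define s where "s = (1 - d) / 2"
  have "d\<^sup>2 = 1 + 4 * m" using m by (simp add: d_def)
  moreover have d: "d \<ge> 3" unfolding d_def using m by (intro real_le_rsqrt) simp
  ultimately have rs: "r + s = 1" "r * s = - m" "r \<noteq> s"
    by (auto simp: r_def s_def power2_eq_square field_simps)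
  have r: "r \<ge> 1" "s \<le> -1" using d by (auto simp: r_def s_def)
  have sq: "r\<^sup>2 \<ge> 1" "s\<^sup>2 \<ge> 1" using r power_mono[of 1 r 2] power_mono[of 1 "-s" 2] by auto
  have "\<exists>f. \<forall>u\<in>V. \<forall>v\<in>V. poly_at V A ([:-1, 0, 1:] * [:-s, 1:]) u v = (r - s) * (f u * f v)"
    by (rule rank_one_component[OF fin sym ann tr1 tr2 rs sq(1)])
  then obtain f where f: "\<forall>u\<in>V. \<forall>v\<in>V. poly_at V A ([:-1, 0, 1:] * [:-s, 1:]) u v = (r - s) * (f u * f v)"
    by (elim exE)
  have "s + r = 1" "s * r = - m" "s \<noteq> r" using rs by (simp_all add: algebra_simps)
  then have "\<exists>g. \<forall>u\<in>V. \<forall>v\<in>V. poly_at V A ([:-1, 0, 1:] * [:-r, 1:]) u v = (s - r) * (g u * g v)"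
    by (intro rank_one_component[OF fin sym ann tr1 tr2 _ _ _ sq(2)])
  then obtain g where g: "\<forall>u\<in>V. \<forall>v\<in>V. poly_at V A ([:-1, 0, 1:] * [:-r, 1:]) u v = (s - r) * (g u * g v)"
    by (elim exE)
  have "poly_at V A [:-1, 0, 1:] u v = f u * f v + g u * g v" if "u \<in> V" "v \<in> V" for u v
  proof -
    have "Polynomial.smult (r - s) [:-1, 0, 1:] = [:-1, 0, 1:] * [:-s, 1:] - [:-1, 0, 1:] * [:-r, 1:]"
      by simp
    then have "(r - s) * poly_at V A [:-1, 0, 1:] u v =
        (r - s) * (f u * f v) - (s - r) * (g u * g v)"
      using f g that by (simp only: poly_at_diff poly_at_smult[symmetric])
    also have "\<dots> = (r - s) * (f u * f v + g u * g v)" by (simp add: algebra_simps)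
    finally show ?thesis using rs(3) by simp
  qed
  then have "\<forall>u\<in>V. \<forall>v\<in>V. poly_at V A [:-1, 0, 1:] u v = f u * f v + g u * g v"
    by (intro ballI)
  then show ?thesis by (intro exI[of _ f] exI[of _ g])
qed

section \<open>The friendship graph\<close>

text \<open>The other noncentral vertex of the triangle that contains the noncentral vertex \<open>v\<close>.\<close>

definition partner :: "nat \<Rightarrow> nat" where
  "partner v = (if odd v then v + 1 else v - 1)"

lemma partner_partner [simp]: "v \<ge> 1 \<Longrightarrow> partner (partner v) = v"
  unfolding partner_def by simp

lemma partner_neq [simp]:
  assumes "v \<ge> 1"
  shows "partner v \<noteq> v" "v \<noteq> partner v"
  using assms unfolding partner_def by (cases "odd v"; simp)+

lemma partner_in [simp]:
  assumes "v \<in> {1..2 * l}"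
  shows "partner v \<in> {1..2 * l}"
proof (cases "odd v")
  case True
  then obtain k where "v = 2 * k + 1" by (elim oddE)
  moreover have "k < l" using assms calculation by simp
  ultimately show ?thesis by (simp add: partner_def)
next
  case False
  then show ?thesis using assms by (auto simp: partner_def)
qed

lemma partner_inject:
  assumes "u \<ge> 1" "v \<ge> 1"
  shows "partner u = partner v \<longleftrightarrow> u = v"
proof
  assume "partner u = partner v"
  then have "partner (partner u) = partner (partner v)" by (rule arg_cong)
  then show "u = v" unfolding partner_partner[OF assms(1)] partner_partner[OF assms(2)] .
qed simp

lemma edge_friendship_graph_iff:
  "{u, v} \<in> edges (friendship_graph l) \<longleftrightarrow>
    u \<le> 2 * l \<and> v \<le> 2 * l \<and> u \<noteq> v \<and> (u = 0 \<or> v = 0 \<or> v = partner u)"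
  (is "?L \<longleftrightarrow> ?R")
proof
  assume ?L
  then show ?R by (auto simp: friendship_graph_def partner_def doubleton_eq_iff)
next
  assume R: ?R
  \<comment> \<open>the noncentral vertex \<open>w\<close> lies in the triangle numbered \<open>(w - 1) div 2\<close>\<close>
  have half: "(w - 1) div 2 < l \<and> (w = 2 * ((w - 1) div 2) + 1 \<or> w = 2 * ((w - 1) div 2) + 2)"
    if "w \<ge> 1" "w \<le> 2 * l" for w :: nat
    using that by presburger
  consider "u = 0" "v \<ge> 1" | "v = 0" "u \<ge> 1" | "u \<ge> 1" "v \<ge> 1" "v = partner u"
    using R by linarith
  then show ?L
  proof cases
    case 1
    then show ?thesis using half[of v] R unfolding friendship_graph_def
      by (simp, intro bexI[of _ "(v - 1) div 2"]) auto
  next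
    case 2
    then show ?thesis using half[of u] R unfolding friendship_graph_def
      by (simp, intro bexI[of _ "(u - 1) div 2"]) (auto simp: insert_commute)
  next
    case 3
    show ?thesis
    proof (cases "odd u")
      case True
      then obtain k where "u = 2 * k + 1" by (auto elim: oddE)
      then show ?thesis using 3 R unfolding friendship_graph_def partner_def
        by (simp, intro bexI[of _ k]) auto
    next
      case False
      then obtain k where k: "u = 2 * k" by (auto elim: evenE)
      with 3(1) obtain j where "k = Suc j" by (cases k) auto
      then show ?thesis using 3 R k unfolding friendship_graph_def partner_def
        by (simp, intro bexI[of _ j]) (auto simp: insert_commute)
    qed
  qed
qed

abbreviation friend_adj :: "nat \<Rightarrow> nat \<Rightarrow> nat \<Rightarrow> real" where
  "friend_adj l \<equiv> (\<lambda>u v. real_of_int (sadj (friendship_graph l) u v))"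

lemma sum_friend_adj:
  assumes v: "v \<le> 2 * l"
  shows "(\<Sum>w\<in>{0..2 * l}. f w * friend_adj l w v) =
    (if v = 0 then (\<Sum>w\<in>{1..2 * l}. f w) else f 0 + f (partner v))"
proof (cases "v = 0")
  case True
  have "(\<Sum>w\<in>{0..2 * l}. f w * friend_adj l w v) = (\<Sum>w\<in>{1..2 * l}. f w)"
    using True by (intro sum.mono_neutral_cong_right)
      (auto simp: sadj_def edge_friendship_graph_iff friendship_graph_def[THEN arg_cong[of _ _ esign]])
  then show ?thesis using True by simp
next
  case False
  then have p: "partner v \<in> {1..2 * l}" "v \<ge> 1" using v partner_in[of v l] by auto
  have "(\<Sum>w\<in>{0..2 * l}. f w * friend_adj l w v) = (\<Sum>w\<in>{0, partner v}. f w)"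
  proof (rule sum.mono_neutral_cong_right)
    show "\<forall>w\<in>{0..2 * l} - {0, partner v}. f w * friend_adj l w v = 0"
      using p(2) by (auto simp: sadj_def edge_friendship_graph_iff)
    show "f w * friend_adj l w v = f w" if "w \<in> {0, partner v}" for w
      using p that v partner_neq(1)[OF p(2)]
      by (auto simp: sadj_def edge_friendship_graph_iff friendship_graph_def[THEN arg_cong[of _ _ esign]])
  qed (use p in auto)
  then show ?thesis using p False by auto
qed

text \<open>Any two distinct vertices have exactly one common neighbour, so \<open>B = A\<^sup>2 - I\<close> is the all-ones
matrix except for the entry of the centre; multiplication by \<open>A\<close> then amounts to summing rows.\<close>

lemma friendship_walks:
  assumes u: "u \<le> 2 * l" and v: "v \<le> 2 * l"
  defines "V \<equiv> {0..2 * l}"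
  shows "poly_at V (friend_adj l) [:-1, 0, 1:] u v = (if u = 0 \<and> v = 0 then 2 * real l - 1 else 1)"
    and "poly_at V (friend_adj l) ([:-1, 0, 1:] * [:0, 1:]) u v =
      (if u = 0 then 2 * real l else if v = 0 then 2 * real l else 2)"
    and "poly_at V (friend_adj l) ([:-1, 0, 1:] * [:0, 1:] * [:0, 1:]) u v =
      (if u = 0 then if v = 0 then 4 * (real l)\<^sup>2 else 4 * real l
       else if v = 0 then 4 * real l else 2 * real l + 2)"
proof -
  let ?A = "friend_adj l"
  have fin: "finite V" and V: "w \<in> V \<longleftrightarrow> w \<le> 2 * l" for w by (auto simp: V_def)
  have A: "?A x y = of_bool (x \<noteq> y \<and> (x = 0 \<or> y = 0 \<or> y = partner x))" if "x \<le> 2 * l" "y \<le> 2 * l" for x y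
    using that by (auto simp: sadj_def edge_friendship_graph_iff friendship_graph_def[THEN arg_cong[of _ _ esign]])
  have card0: "(\<Sum>w\<in>{1..2 * l}. c) = 2 * real l * c" for c :: real by simp
  have p: "partner y \<le> 2 * l \<and> partner y \<ge> 1" if "y \<le> 2 * l" "y \<noteq> 0" for y
    using that partner_in[of y l] by auto
  have B: "poly_at V ?A [:-1, 0, 1:] x y = (if x = 0 \<and> y = 0 then 2 * real l - 1 else 1)"
    if x: "x \<le> 2 * l" and y: "y \<le> 2 * l" for x y
  proof -
    have "(\<Sum>w\<in>V. ?A x w * ?A w y) = (if y = 0 then (\<Sum>w\<in>{1..2 * l}. ?A x w) else ?A x 0 + ?A x (partner y))"
      unfolding V_def by (rule sum_friend_adj[OF y])
    also have "(\<Sum>w\<in>{1..2 * l}. ?A x w) = (if x = 0 then 2 * real l else 1)"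
    proof (cases "x = 0")
      case True
      then have "(\<Sum>w\<in>{1..2 * l}. ?A x w) = (\<Sum>w\<in>{1..2 * l}. 1)"
        by (intro sum.cong) (auto simp: A)
      then show ?thesis using True by simp
    next
      case False
      then have "(\<Sum>w\<in>{1..2 * l}. ?A x w) = (\<Sum>w\<in>{1..2 * l}. if w = partner x then 1 else 0)"
        using x p[of x] by (intro sum.cong) (auto simp: A)
      then show ?thesis using False p[OF x] by simp
    qed
    finally have "(\<Sum>w\<in>V. ?A x w * ?A w y) = (if y = 0 then if x = 0 then 2 * real l else 1 else ?A x 0 + ?A x (partner y))" .
    moreover have inj: "x \<noteq> 0 \<longrightarrow> y \<noteq> 0 \<longrightarrow> partner y = partner x \<longleftrightarrow> y = x"
      using partner_inject[of y x] by auto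
    ultimately show ?thesis
      using x y p[OF x] p[OF y] partner_partner[of x] partner_partner[of y] partner_neq(1)[of y] inj fin V
      by (simp add: poly_at_sq_minus_1 A split: if_splits) auto
  qed
  have X: "poly_at V ?A (q * [:0, 1:]) x y =
      (if y = 0 then (\<Sum>w\<in>{1..2 * l}. poly_at V ?A q x w) else poly_at V ?A q x 0 + poly_at V ?A q x (partner y))"
    if "x \<le> 2 * l" "y \<le> 2 * l" for x y q
    using poly_at_mult_X[OF fin, of x y ?A q] sum_friend_adj[OF that(2), of "poly_at V ?A q x"] that V
    unfolding V_def by simp
  have BX: "poly_at V ?A ([:-1, 0, 1:] * [:0, 1:]) x y =
      (if x = 0 then 2 * real l else if y = 0 then 2 * real l else 2)"
    if x: "x \<le> 2 * l" and y: "y \<le> 2 * l" for x y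
  proof -
    have "(\<Sum>w\<in>{1..2 * l}. poly_at V ?A [:-1, 0, 1:] x w) = (\<Sum>w\<in>{1..2 * l}. 1)"
      using x by (intro sum.cong) (auto simp: B)
    then show ?thesis using X[OF that, of "[:-1, 0, 1:]"] p[OF y] B[OF x] x y by auto
  qed
  have BXX: "poly_at V ?A ([:-1, 0, 1:] * [:0, 1:] * [:0, 1:]) x y =
      (if x = 0 then if y = 0 then 4 * (real l)\<^sup>2 else 4 * real l
       else if y = 0 then 4 * real l else 2 * real l + 2)"
    if x: "x \<le> 2 * l" and y: "y \<le> 2 * l" for x y
  proof -
    have "(\<Sum>w\<in>{1..2 * l}. poly_at V ?A ([:-1, 0, 1:] * [:0, 1:]) x w) =
        (\<Sum>w\<in>{1..2 * l}. if x = 0 then 2 * real l else 2)"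
      using x by (intro sum.cong) (auto simp: BX simp del: mult_pCons_left mult_pCons_right)
    then show ?thesis using X[OF that, of "[:-1, 0, 1:] * [:0, 1:]"] p[OF y] BX[OF x] x y
      by (auto simp: power2_eq_square)
  qed
  show "poly_at V ?A [:-1, 0, 1:] u v = (if u = 0 \<and> v = 0 then 2 * real l - 1 else 1)"
    using B[OF u v] .
  show "poly_at V ?A ([:-1, 0, 1:] * [:0, 1:]) u v =
      (if u = 0 then 2 * real l else if v = 0 then 2 * real l else 2)"
    using BX[OF u v] .
  show "poly_at V ?A ([:-1, 0, 1:] * [:0, 1:] * [:0, 1:]) u v =
      (if u = 0 then if v = 0 then 4 * (real l)\<^sup>2 else 4 * real l
       else if v = 0 then 4 * real l else 2 * real l + 2)"
    using BXX[OF u v] .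
qed

lemma friendship_annihilated:
  assumes "u \<le> 2 * l" "v \<le> 2 * l"
  shows "poly_at {0..2 * l} (friend_adj l) ([:-1, 0, 1:] * [:- real (2 * l), -1, 1:]) u v = 0"
proof -
  have "[:-1, 0, 1:] * [:- real (2 * l), -1, 1:] = [:-1, 0, 1:] * [:0, 1:] * [:0, 1:]
      - [:-1, 0, 1:] * [:0, 1:] - Polynomial.smult (real (2 * l)) [:-1, 0, 1:]"
    by simp
  then show ?thesis
    by (simp only: poly_at_diff poly_at_smult friendship_walks[OF assms])
      (auto simp: power2_eq_square algebra_simps)
qed

lemma friendship_traces:
  "trace_at {0..2 * l} (friend_adj l) [:-1, 0, 1:] = 2 * real (2 * l) - 1"
  "trace_at {0..2 * l} (friend_adj l) ([:-1, 0, 1:] * [:0, 1:]) = 3 * real (2 * l)"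
proof -
  have split: "(\<Sum>u\<in>{0..2 * l}. h u) = h 0 + 2 * real l * c"
    if "\<And>u. u \<in> {1..2 * l} \<Longrightarrow> h u = c" for h :: "nat \<Rightarrow> real" and c
  proof -
    have "(\<Sum>u\<in>{1..2 * l}. h u) = (\<Sum>u\<in>{1..2 * l}. c)"
      using that by (rule sum.cong[OF refl])
    then show ?thesis by (simp add: sum.atLeast_Suc_atMost)
  qed
  show "trace_at {0..2 * l} (friend_adj l) [:-1, 0, 1:] = 2 * real (2 * l) - 1"
    unfolding trace_at_def
    by (subst split[where c = 1]) (simp_all only: friendship_walks(1) atLeastAtMost_iff, auto)
  show "trace_at {0..2 * l} (friend_adj l) ([:-1, 0, 1:] * [:0, 1:]) = 3 * real (2 * l)"
    unfolding trace_at_def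
    by (subst split[where c = 2]) (simp_all only: friendship_walks(2) atLeastAtMost_iff, auto)
qed

section \<open>Walks in a graph cospectral with a friendship graph\<close>

text \<open>The annihilating polynomial \<open>(x\<^sup>2 - 1)(x\<^sup>2 - x - 2 l)\<close> of the friendship graph also
annihilates the adjacency matrix of \<open>G\<close>. The identities for \<open>B\<^sup>2\<close> and \<open>A B
A\<close> are its consequences, and with the two traces it gives the factorisation of \<open>B\<close>.\<close>

lemma cospectral_friendship_walks:
  fixes G :: "'a sgraph"
  assumes "l \<ge> 1" "signed_graph G" "cospectral G (friendship_graph l)"
  defines "V \<equiv> verts G" and "A \<equiv> sadj G"
    and "B \<equiv> (\<lambda>u v. (\<Sum>w\<in>verts G. sadj G u w * sadj G w v) - of_bool (u = v))"
  shows "card V = 2 * l + 1"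
    and "(\<Sum>u\<in>V. B u u) = 4 * int l - 1"
    and "\<And>u v. u \<in> V \<Longrightarrow> v \<in> V \<Longrightarrow>
      (\<Sum>w\<in>V. B u w * B w v) = (\<Sum>w\<in>V. B u w * A w v) + (2 * int l - 1) * B u v"
    and "\<And>u v. u \<in> V \<Longrightarrow> v \<in> V \<Longrightarrow> (\<Sum>w\<in>V. A u w * B w v) = (\<Sum>w\<in>V. B u w * A w v)"
    and "\<And>u v. u \<in> V \<Longrightarrow> v \<in> V \<Longrightarrow>
      (\<Sum>x\<in>V. A u x * (\<Sum>y\<in>V. B x y * A y v)) = (\<Sum>w\<in>V. B u w * A w v) + 2 * int l * B u v"
    and "\<exists>f g :: 'a \<Rightarrow> real. \<forall>u\<in>V. \<forall>v\<in>V. B u v = f u * f v + g u * g v"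
proof -
  interpret signed_graph G by fact
  let ?m = "real (2 * l)"
  let ?A = "\<lambda>u v. real_of_int (A u v)"
  let ?sq1 = "[:-1, 0, 1:] :: real poly" and ?X = "[:0, 1:] :: real poly"
  let ?ann = "?sq1 * [:- ?m, -1, 1:]"
  have fin: "finite V" using finite_verts by (simp add: V_def)
  have sym: "?A u v = ?A v u" for u v by (simp add: A_def sadj_sym)
  have tr: "trace_at V ?A p = trace_at {0..2 * l} (friend_adj l) p" for p
    using cospectral_trace_at[OF assms(3), of p] finite_verts
    by (simp add: V_def A_def friendship_graph_def)
  have "trace_at V ?A [:1:] = real (card V)"
    by (simp add: trace_at_def poly_at_pCons)
  moreover have "trace_at {0..2 * l} (friend_adj l) [:1:] = 2 * l + 1"
    by (simp add: trace_at_def poly_at_pCons)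
  ultimately show "card V = 2 * l + 1" using tr[of "[:1:]"] by linarith
  have B: "poly_at V ?A ?sq1 u v = B u v" if "v \<in> V" for u v
    using poly_at_sq_minus_1[OF fin that, of ?A u] by (simp add: B_def V_def A_def)
  have ann: "poly_at V ?A ?ann u v = 0" if "u \<in> V" "v \<in> V" for u v
  proof (rule poly_at_eq_0_if_trace_sq_eq_0[OF fin sym _ that])
    have "poly_at {0..2 * l} (friend_adj l) (?ann * ?ann) u u = 0" if "u \<in> {0..2 * l}" for u
      unfolding poly_at_mult[OF finite_atLeastAtMost that, of _ ?ann]
      using that by (intro sum.neutral ballI) (simp only: atLeastAtMost_iff friendship_annihilated mult_zero_left)
    then have "trace_at {0..2 * l} (friend_adj l) (?ann * ?ann) = 0"
      unfolding trace_at_def by (rule sum.neutral[OF ballI])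
    then show "trace_at V ?A (?ann * ?ann) = 0"
      by (simp only: tr)
  qed
  have trB: "trace_at V ?A ?sq1 = 2 * ?m - 1" and trBX: "trace_at V ?A (?sq1 * ?X) = 3 * ?m"
    unfolding tr using friendship_traces by simp_all
  have "real_of_int (\<Sum>u\<in>V. B u u) = real_of_int (4 * int l - 1)"
    using trB by (simp add: trace_at_def B del: of_int_sum add: of_int_sum[symmetric])
  then show "(\<Sum>u\<in>V. B u u) = 4 * int l - 1" by linarith
  have BX: "poly_at V ?A (?sq1 * ?X) u v = real_of_int (\<Sum>w\<in>V. B u w * A w v)" if "u \<in> V" "v \<in> V" for u v
    using poly_at_mult_X[OF fin that, of ?A ?sq1] by (simp add: B cong: sum.cong_simp)
  {
    fix u v assume uv: "u \<in> V" "v \<in> V"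
    have "?sq1 * ?sq1 = ?ann + ?sq1 * ?X + Polynomial.smult (?m - 1) ?sq1" by simp
    then have "poly_at V ?A (?sq1 * ?sq1) u v =
        poly_at V ?A (?sq1 * ?X) u v + (?m - 1) * poly_at V ?A ?sq1 u v"
      by (simp only: poly_at_add poly_at_smult ann[OF uv])
    then have "real_of_int (\<Sum>w\<in>V. B u w * B w v) =
        real_of_int ((\<Sum>w\<in>V. B u w * A w v) + (2 * int l - 1) * B u v)"
      using uv unfolding BX[OF uv] poly_at_mult[OF fin uv(1), of ?A ?sq1 ?sq1] by (simp add: B)
    then show "(\<Sum>w\<in>V. B u w * B w v) = (\<Sum>w\<in>V. B u w * A w v) + (2 * int l - 1) * B u v"
      unfolding of_int_eq_iff .
    have "poly_at V ?A (?X * ?sq1) u v = (\<Sum>w\<in>V. ?A u w * B w v)"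
      using poly_at_mult[OF fin uv(1), of ?A ?X ?sq1] uv by (simp add: B poly_at_X[OF fin] del: mult_pCons_left)
    then have "real_of_int (\<Sum>w\<in>V. A u w * B w v) = real_of_int (\<Sum>w\<in>V. B u w * A w v)"
      using BX[OF uv] by (simp add: mult.commute[of ?X])
    then show "(\<Sum>w\<in>V. A u w * B w v) = (\<Sum>w\<in>V. B u w * A w v)"
      unfolding of_int_eq_iff .
    have "?X * (?sq1 * ?X) = ?ann + ?sq1 * ?X + Polynomial.smult ?m ?sq1" by simp
    then have "poly_at V ?A (?X * (?sq1 * ?X)) u v =
        poly_at V ?A (?sq1 * ?X) u v + ?m * poly_at V ?A ?sq1 u v"
      by (simp only: poly_at_add poly_at_smult ann[OF uv])
    then have "real_of_int (\<Sum>x\<in>V. A u x * (\<Sum>y\<in>V. B x y * A y v)) =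
        real_of_int ((\<Sum>w\<in>V. B u w * A w v) + 2 * int l * B u v)"
      using uv unfolding poly_at_mult[OF fin uv(1), of ?A ?X "?sq1 * ?X"] BX[OF uv]
      by (simp add: B BX poly_at_X[OF fin] del: mult_pCons_left mult_pCons_right cong: sum.cong_simp)
    then show "(\<Sum>x\<in>V. A u x * (\<Sum>y\<in>V. B x y * A y v)) =
        (\<Sum>w\<in>V. B u w * A w v) + 2 * int l * B u v"
      unfolding of_int_eq_iff .
  }
  have "?m \<ge> 2" using assms(1) by simp
  from sq_minus_1_rank_two[OF fin sym ann trB trBX this]
  show "\<exists>f g :: 'a \<Rightarrow> real. \<forall>u\<in>V. \<forall>v\<in>V. B u v = f u * f v + g u * g v"
    using B by simp
qed

section \<open>Vertices of degree two\<close>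

text \<open>The combinatorial part works with integers only, apart from the two planar coordinates in \<open>gram\<close>.
The assumption \<open>connected\<close> is connectedness in the form in which it is applied: a nonempty set of
vertices that is closed under adjacency contains all of them.\<close>

locale friendship_like =
  fixes V :: "'a set" and A B :: "'a \<Rightarrow> 'a \<Rightarrow> int" and l :: nat
  assumes fin: "finite V" and card_V: "card V = 2 * l + 1" and l_ge_1: "l \<ge> 1"
    and A_val: "\<And>u v. A u v \<in> {-1, 0, 1}"
    and A_sym: "\<And>u v. A u v = A v u"
    and A_diag: "\<And>u. A u u = 0"
    and B_eq: "\<And>u v. B u v = (\<Sum>w\<in>V. A u w * A w v) - of_bool (u = v)"
    and tr_B: "(\<Sum>u\<in>V. B u u) = 4 * int l - 1"
    and BB: "\<And>u v. u \<in> V \<Longrightarrow> v \<in> V \<Longrightarrow>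
      (\<Sum>w\<in>V. B u w * B w v) = (\<Sum>w\<in>V. B u w * A w v) + (2 * int l - 1) * B u v"
    and AB: "\<And>u v. u \<in> V \<Longrightarrow> v \<in> V \<Longrightarrow> (\<Sum>w\<in>V. A u w * B w v) = (\<Sum>w\<in>V. B u w * A w v)"
    and ABA: "\<And>u v. u \<in> V \<Longrightarrow> v \<in> V \<Longrightarrow>
      (\<Sum>x\<in>V. A u x * (\<Sum>y\<in>V. B x y * A y v)) = (\<Sum>w\<in>V. B u w * A w v) + 2 * int l * B u v"
    and gram: "\<exists>f g :: 'a \<Rightarrow> real. \<forall>u\<in>V. \<forall>v\<in>V. B u v = f u * f v + g u * g v"
    and connected: "\<And>S. S \<subseteq> V \<Longrightarrow> S \<noteq> {} \<Longrightarrow>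
      (\<And>u v. u \<in> S \<Longrightarrow> v \<in> V \<Longrightarrow> A u v \<noteq> 0 \<Longrightarrow> v \<in> S) \<Longrightarrow> S = V"
begin

definition nb :: "'a \<Rightarrow> 'a set" where
  "nb u = {v \<in> V. A u v \<noteq> 0}"

lemma finite_nb [simp]: "finite (nb u)"
  using fin by (simp add: nb_def)

lemma nb_sym: "u \<in> V \<Longrightarrow> v \<in> V \<Longrightarrow> v \<in> nb u \<longleftrightarrow> u \<in> nb v"
  by (simp add: nb_def A_sym)

lemma not_in_nb_self: "u \<notin> nb u"
  by (simp add: nb_def A_diag)

lemma B_sym: "B u v = B v u"
  unfolding B_eq by (intro arg_cong2[where f = "(-)"] sum.cong) (auto simp: A_sym mult.commute)

lemma A_sq: "A u v * A u v = of_bool (A u v \<noteq> 0)"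
  using A_val[of u v] by auto

lemma sum_nb: "(\<Sum>w\<in>V. A u w * f w) = (\<Sum>w\<in>nb u. A u w * f w)"
  by (rule sum.mono_neutral_right) (auto simp: nb_def fin)

lemma B_diag: "B u u = int (card (nb u)) - 1"
proof -
  have "(\<Sum>w\<in>V. A u w * A w u) = (\<Sum>w\<in>nb u. A u w * A w u)" by (rule sum_nb)
  also have "\<dots> = (\<Sum>w\<in>nb u. 1)"
    by (intro sum.cong refl) (subst (2) A_sym, simp add: A_sq nb_def)
  finally show ?thesis by (simp add: B_eq)
qed

lemma minor_nonneg:
  assumes "u \<in> V" "v \<in> V"
  shows "(B u v)\<^sup>2 \<le> B u u * B v v"
proof -
  obtain f g :: "'a \<Rightarrow> real" where fg: "\<forall>u\<in>V. \<forall>v\<in>V. B u v = f u * f v + g u * g v"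
    using gram by (elim exE)
  have "real_of_int (B u u * B v v - (B u v)\<^sup>2) = (f u * g v - g u * f v)\<^sup>2"
    using fg assms by (simp add: power2_eq_square algebra_simps)
  then have "real_of_int (B u u * B v v - (B u v)\<^sup>2) \<ge> 0" by simp
  then show ?thesis unfolding of_int_0_le_iff by simp
qed

lemma B_diag_nonneg:
  assumes "u \<in> V"
  shows "B u u \<ge> 0"
proof -
  obtain f g :: "'a \<Rightarrow> real" where fg: "\<forall>u\<in>V. \<forall>v\<in>V. B u v = f u * f v + g u * g v"
    using gram by (elim exE)
  have "real_of_int (B u u) \<ge> 0" using fg assms by simp
  then show ?thesis by simp
qed

text \<open>If \<open>i\<close> carries a unit vector, then subtracting from the Gram matrix the part in direction
\<open>i\<close> leaves the Gram matrix of the orthogonal components, which lie on a line; \<open>y\<close> is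
the coordinate on that line.\<close>

lemma schur_complement:
  assumes i: "i \<in> V" "B i i = 1"
  obtains y :: "'a \<Rightarrow> real" where "\<And>j k. j \<in> V \<Longrightarrow> k \<in> V \<Longrightarrow> B j k - B i j * B i k = y j * y k"
proof -
  obtain f g :: "'a \<Rightarrow> real" where fg: "\<forall>u\<in>V. \<forall>v\<in>V. B u v = f u * f v + g u * g v"
    using gram by (elim exE)
  have one: "f i * f i + g i * g i = 1" using fg i by fastforce
  have "B j k - B i j * B i k = (f i * g j - g i * f j) * (f i * g k - g i * f k)"
    if "j \<in> V" "k \<in> V" for j k
  proof -
    have "real_of_int (B j k - B i j * B i k) =
        (f j * f k + g j * g k) - (f i * f j + g i * g j) * (f i * f k + g i * g k)"
      using fg i that by simp
    also have "\<dots> = (f j * f k + g j * g k) * (f i * f i + g i * g i)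
        - (f i * f j + g i * g j) * (f i * f k + g i * g k)"
      by (simp only: one mult_1_right)
    also have "\<dots> = (f i * g j - g i * f j) * (f i * g k - g i * f k)"
      by (simp add: algebra_simps)
    finally show ?thesis .
  qed
  then show ?thesis by (rule that)
qed

lemma schur_nonneg:
  assumes "i \<in> V" "B i i = 1" "k \<in> V"
  shows "B k k - (B i k)\<^sup>2 \<ge> 0"
  using minor_nonneg[OF assms(1,3)] assms(2) by simp

lemma schur_sq:
  assumes "i \<in> V" "B i i = 1" "j \<in> V" "k \<in> V"
  shows "(B j k - B i j * B i k)\<^sup>2 = (B j j - (B i j)\<^sup>2) * (B k k - (B i k)\<^sup>2)"
proof -
  obtain y :: "'a \<Rightarrow> real" where y: "\<And>j k. j \<in> V \<Longrightarrow> k \<in> V \<Longrightarrow> B j k - B i j * B i k = y j * y k"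
    using schur_complement[OF assms(1,2)] by metis
  have "real_of_int ((B j k - B i j * B i k)\<^sup>2) =
      real_of_int ((B j j - (B i j)\<^sup>2) * (B k k - (B i k)\<^sup>2))"
    using y[OF assms(3,4)] y[OF assms(3,3)] y[OF assms(4,4)]
    by (simp add: power2_eq_square)
  then show ?thesis unfolding of_int_eq_iff .
qed

text \<open>The diagonal of a Gram matrix is nonnegative, which excludes degree zero. A vertex of degree one carries the
zero vector. Because \<open>A\<close> and \<open>B\<close> commute, so does its neighbour, which thus has degree
one as well. The two vertices would form a component.\<close>

lemma B_diag_ge_1:
  assumes u: "u \<in> V"
  shows "B u u \<ge> 1"
proof (rule ccontr)
  assume "\<not> ?thesis"
  then have "B u u = 0" using B_diag_nonneg[OF u] by simp
  then have row: "B u v = 0" if "v \<in> V" for v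
    using minor_nonneg[OF u that] by simp
  have "card (nb u) = 1" using B_diag[of u] \<open>B u u = 0\<close> by simp
  then obtain p where p: "nb u = {p}" by (rule card_1_singletonE)
  then have pV: "p \<in> V" and up: "A u p \<noteq> 0" by (auto simp: nb_def)
  have "A u p * B p p = (\<Sum>w\<in>V. A u w * B w p)" by (simp add: sum_nb p)
  also have "\<dots> = (\<Sum>w\<in>V. B u w * A w p)" by (rule AB[OF u pV])
  also have "\<dots> = 0" using row by simp
  finally have "B p p = 0" using up by simp
  then have "card (nb p) = 1" using B_diag[of p] by simp
  moreover have "u \<in> nb p" using u up by (simp add: nb_def A_sym)
  ultimately have "nb p = {u}" by (metis card_1_singletonE singletonD)
  then have "{u, p} = V"
    using u pV p by (intro connected) (auto simp: nb_def)
  moreover have "card {u, p} \<le> 2" by (simp add: card_insert_if)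
  ultimately have "card V \<le> 2" by simp
  then show False using card_V l_ge_1 by simp
qed

text \<open>The vertices of degree two, called units because their vectors have length one.\<close>

definition U :: "'a set" where
  "U = {u \<in> V. B u u = 1}"

lemma U_subset: "U \<subseteq> V" and finite_U [simp]: "finite U"
  using fin by (auto simp: U_def)

lemma U_D: "i \<in> U \<Longrightarrow> i \<in> V" "i \<in> U \<Longrightarrow> B i i = 1"
  by (auto simp: U_def)

lemma nonunit: "k \<in> V - U \<Longrightarrow> B k k \<ge> 2"
  using B_diag_ge_1[of k] by (auto simp: U_def)

text \<open>This identity is the main source of counting: the degrees of the other vertices exceed three in total by only
\<open>card U - 3\<close>.\<close>

lemma unit_excess: "(\<Sum>k\<in>V - U. B k k - 2) = int (card U) - 3"
proof -
  have "(\<Sum>k\<in>V. B k k - 2) = (\<Sum>k\<in>V - U. B k k - 2) + (\<Sum>k\<in>U. B k k - 2)"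
    using sum.subset_diff[OF U_subset fin] .
  moreover have "(\<Sum>k\<in>U. B k k - 2) = - int (card U)"
    by (simp add: U_D)
  moreover have "(\<Sum>k\<in>V. B k k - 2) = - 3"
    by (simp add: sum_subtractf tr_B card_V)
  ultimately show ?thesis by simp
qed

lemma card_U_ge_3: "card U \<ge> 3"
proof -
  have "(\<Sum>k\<in>V - U. B k k - 2) \<ge> 0" using nonunit by (intro sum_nonneg) force
  then show ?thesis by (simp add: unit_excess)
qed

lemma unit_nb:
  assumes "i \<in> U"
  obtains p q where "nb i = {p, q}" "p \<noteq> q"
proof -
  have "card (nb i) = 2" using B_diag[of i] U_D(2)[OF assms] by simp
  then show ?thesis using that by (auto simp: card_2_iff)
qed

lemma unit_nb_other:
  assumes "i \<in> U" "p \<in> nb i"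
  obtains q where "nb i = {p, q}" "p \<noteq> q"
proof -
  obtain a b where ab: "nb i = {a, b}" "a \<noteq> b"
    by (rule unit_nb[OF assms(1)])
  show ?thesis
  proof (cases "p = a")
    case True
    then show ?thesis using that[of b] ab by simp
  next
    case False
    then show ?thesis using that[of a] ab assms(2) by auto
  qed
qed

lemma unit_sum:
  assumes "nb i = {p, q}" "p \<noteq> q"
  shows "(\<Sum>w\<in>V. A i w * f w) = A i p * f p + A i q * f q"
  using assms by (simp add: sum_nb)

lemma unit_row:
  assumes "nb i = {p, q}" "p \<noteq> q"
  shows "B i j = A i p * A p j + A i q * A q j - of_bool (i = j)"
  using unit_sum[OF assms, of "\<lambda>w. A w j"] by (simp add: B_eq)

lemma unit_nb_A:
  assumes "nb i = {p, q}"
  shows "A i p \<in> {-1, 1}" "A i q \<in> {-1, 1}"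
proof -
  have "p \<in> nb i" "q \<in> nb i" using assms by auto
  then show "A i p \<in> {-1, 1}" "A i q \<in> {-1, 1}"
    using A_val[of i p] A_val[of i q] by (auto simp: nb_def)
qed

lemma unit_row_nb:
  assumes "nb i = {p, q}" "p \<noteq> q"
  shows "B i p = A i q * A p q" "B i q = A i p * A p q"
proof -
  have "p \<noteq> i" "q \<noteq> i" using assms not_in_nb_self[of i] by auto
  then show "B i p = A i q * A p q" "B i q = A i p * A p q"
    using unit_row[OF assms] by (auto simp: A_diag A_sym)
qed

text \<open>Entry \<open>(i, i)\<close> of \<open>A\<^sup>3\<close> up to the vanishing diagonal term of \<open>A\<close>,
that is, twice the signed number of triangles at \<open>i\<close>.\<close>

definition T :: "'a \<Rightarrow> int" where
  "T i = (\<Sum>w\<in>V. A i w * B w i)"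

lemma T_unit:
  assumes "nb i = {p, q}" "p \<noteq> q"
  shows "T i = 2 * (A i p * A i q * A p q)"
  unfolding T_def unit_sum[OF assms]
  using unit_row_nb[OF assms] by (simp add: B_sym[of _ i])

lemma T_even: "i \<in> U \<Longrightarrow> even (T i)"
  by (erule unit_nb) (simp add: T_unit)

text \<open>The diagonal entry at \<open>i\<close> of \<open>B\<^sup>2 = B A + (2 l - 1) B\<close>.\<close>

lemma sum_row_sq:
  assumes "i \<in> U"
  shows "(\<Sum>k\<in>V. (B i k)\<^sup>2) = 2 * int l - 1 + T i"
proof -
  have "(\<Sum>k\<in>V. (B i k)\<^sup>2) = (\<Sum>w\<in>V. B i w * B w i)"
    by (intro sum.cong refl) (simp add: power2_eq_square B_sym[of _ i])
  also have "\<dots> = T i + (2 * int l - 1)"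
    using BB[OF U_D(1)[OF assms] U_D(1)[OF assms]] AB[OF U_D(1)[OF assms] U_D(1)[OF assms]]
    by (simp add: T_def U_D(2)[OF assms])
  finally show ?thesis by simp
qed

text \<open>The trace of the component of the Gram matrix orthogonal to \<open>i\<close>.\<close>

lemma sum_schur_diag:
  assumes "i \<in> U"
  shows "(\<Sum>k\<in>V. B k k - (B i k)\<^sup>2) = 2 * int l - T i"
  by (simp add: sum_subtractf sum_row_sq[OF assms] tr_B)

text \<open>The diagonal entry at \<open>i\<close> of \<open>A B A = B A + 2 l B\<close>. It ties the lengths of the vectors
of the two neighbours to \<open>l\<close>.\<close>

lemma unit_ABA:
  assumes i: "i \<in> U" and pq: "nb i = {p, q}" "p \<noteq> q"
  shows "B p p + B q q + 2 * (A i p * A i q * B p q) = 2 * int l + T i"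
proof -
  have inner: "(\<Sum>y\<in>V. B x y * A y i) = A i p * B x p + A i q * B x q" for x
    using unit_sum[OF pq, of "\<lambda>y. B x y"] by (simp add: A_sym[of _ i] mult.commute)
  have "A i p * (A i p * B p p + A i q * B p q) + A i q * (A i p * B q p + A i q * B q q) =
      T i + 2 * int l"
    using ABA[OF U_D(1)[OF i] U_D(1)[OF i]] AB[OF U_D(1)[OF i] U_D(1)[OF i]]
    by (simp only: inner unit_sum[OF pq] T_def U_D(2)[OF i] mult_1_right)
  moreover have "A i p * A i p = 1" "A i q * A i q = 1"
    using unit_nb_A[OF pq(1)] by auto
  moreover have "A i p * (A i p * B p p + A i q * B p q) + A i q * (A i p * B q p + A i q * B q q) =
     (A i p * A i p) * B p p + (A i q * A i q) * B q q + 2 * (A i p * A i q * B p q)"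
    by (simp add: algebra_simps B_sym[of q p])
  ultimately show ?thesis by simp
qed

text \<open>Unit vectors with an integral inner product are orthogonal or equal up to sign. If those of \<open>i\<close> and
\<open>j\<close> were orthogonal, then the component orthogonal to \<open>i\<close> would be the one along
\<open>j\<close>, and comparing its length in \<open>sum_schur_diag\<close> for \<open>i\<close> with that in
\<open>sum_row_sq\<close> for \<open>j\<close> gives \<open>T i + T j = 1\<close>, although both summands are
even.\<close>

lemma units_row:
  assumes i: "i \<in> U" and j: "j \<in> U"
  shows "B i j \<in> {-1, 1}" and "\<And>k. k \<in> V \<Longrightarrow> B j k = B i j * B i k"
proof -
  note i' = U_D[OF i] and j' = U_D[OF j]
  have "(B i j)\<^sup>2 \<le> 1" using minor_nonneg[OF i'(1) j'(1)] i' j' by simp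
  then have val: "B i j \<in> {-1, 0, 1}"
    using power2_le_iff_abs_le[of 1 "B i j"] by auto
  have "B i j \<noteq> 0"
  proof
    assume 0: "B i j = 0"
    have "(B j k)\<^sup>2 = B k k - (B i k)\<^sup>2" if "k \<in> V" for k
      using schur_sq[OF i' j'(1) that] 0 j' by simp
    then have "2 * int l - 1 + T j = 2 * int l - T i"
      using sum_row_sq[OF j] sum_schur_diag[OF i] by simp
    then have "T i + T j = 1" by simp
    moreover have "even (T i + T j)" using T_even[OF i] T_even[OF j] by simp
    ultimately show False by simp
  qed
  then show 1: "B i j \<in> {-1, 1}" using val by auto
  show "B j k = B i j * B i k" if "k \<in> V" for k
    using schur_sq[OF i' j'(1) that] 1 j' by auto
qed

lemma units_row_sq:
  assumes "i \<in> U" "j \<in> U" "k \<in> V"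
  shows "(B j k)\<^sup>2 = (B i k)\<^sup>2"
  using units_row(1)[OF assms(1,2)] units_row(2)[OF assms] by auto

lemma T_const:
  assumes "i \<in> U" "j \<in> U"
  shows "T i = T j"
  using sum_row_sq[OF assms(1)] sum_row_sq[OF assms(2)] units_row_sq[OF assms]
  by (simp cong: sum.cong)

text \<open>The signed number of walks of length two between two units is \<open>1\<close> or \<open>-1\<close>, whereas
zero or two common neighbours give an even number.\<close>

lemma units_common_nb:
  assumes "i \<in> U" "j \<in> U" "i \<noteq> j" "nb i = {p, q}" "p \<noteq> q"
  shows "p \<in> nb j \<longleftrightarrow> q \<notin> nb j"
proof -
  have V: "p \<in> V" "q \<in> V" using assms(4) by (auto simp: nb_def)
  have "A i p * A p j + A i q * A q j \<in> {-1, 1}"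
    using units_row(1)[OF assms(1,2)] unit_row[OF assms(4,5), of j] assms(3) by simp
  then have "A p j \<noteq> 0 \<longleftrightarrow> A q j = 0"
    using unit_nb_A[OF assms(4)] A_val[of p j] A_val[of q j] by auto
  then show ?thesis using V by (simp add: nb_def A_sym[of j])
qed

end

section \<open>Two adjacent vertices of degree two\<close>

context friendship_like
begin

text \<open>The graph is, up to switching, a friendship graph with centre \<open>q\<close>: every other vertex
\<open>k\<close> has degree two and lies in a positive triangle with \<open>q\<close> and its other neighbour
\<open>m\<close>.\<close>

definition friendship_at :: "'a \<Rightarrow> bool" where
  "friendship_at q \<longleftrightarrow> q \<in> V \<and> (\<forall>k\<in>V - {q}. \<exists>m\<in>V - {q}. m \<noteq> k \<and> nb k = {q, m} \<and> A k q * A k m * A q m = 1)"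

text \<open>Let \<open>i, p\<close> be adjacent units and \<open>q\<close> the third vertex of their triangle, of sign
\<open>t\<close>. All units other than \<open>q\<close> are adjacent to \<open>q\<close>, since they share
exactly one neighbour with \<open>i\<close> and cannot share \<open>p\<close>. If \<open>t = 1\<close>, the
vector of \<open>q\<close> exhausts the trace orthogonal to \<open>i\<close>, so all other vectors are multiples
of that of \<open>i\<close>, and counting lengths makes them units. If \<open>t = -1\<close>, counting degrees
shows that the neighbours of \<open>q\<close> are exactly the other units and that four vertices are not reached
from \<open>q\<close>.\<close>

lemma adjacent_units_imp_friendship:
  assumes i: "i \<in> U" and p: "p \<in> U" and ip: "p \<in> nb i"
  shows "\<exists>q. friendship_at q"
proof -
  obtain q where nbi: "nb i = {p, q}" "p \<noteq> q"
    by (rule unit_nb_other[OF i ip])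
  have V: "i \<in> V" "p \<in> V" "q \<in> V" using i p nbi U_subset by (auto simp: nb_def)
  have ne: "i \<noteq> p" "i \<noteq> q" using nbi not_in_nb_self[of i] by auto
  have Aip: "A i p \<in> {-1, 1}" "A i q \<in> {-1, 1}" using unit_nb_A[OF nbi(1)] .
  have Bip: "B i p \<in> {-1, 1}" using units_row(1)[OF i p] .
  have rows: "B i p = A i q * A p q" "B i q = A i p * A p q" using unit_row_nb[OF nbi] .
  then have Apq: "A p q \<in> {-1, 1}" using Bip Aip A_val[of p q] by auto
  define t where "t = A i p * A i q * A p q"
  have t: "t \<in> {-1, 1}" using Aip Apq by (auto simp: t_def)
  have T: "T j = 2 * t" if "j \<in> U" for j
    using T_const[OF that i] T_unit[OF nbi] by (simp add: t_def)
  have nbp: "nb p = {i, q}"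
  proof -
    have "{i, q} \<subseteq> nb p" using Aip Apq V by (auto simp: nb_def A_sym[of p i])
    moreover have "card (nb p) = 2" using B_diag[of p] U_D(2)[OF p] by simp
    ultimately show ?thesis using ne by (intro card_subset_eq[symmetric]) auto
  qed
  have "B p q = B i p * B i q" using units_row(2)[OF i p V(3)] .
  then have "A i p * A i q * B p q = (A i p * A i p) * (A i q * A i q) * (A p q * A p q)"
    by (simp add: rows algebra_simps)
  also have "\<dots> = 1" using Aip Apq by auto
  finally have Bqq: "B q q = 2 * int l + 2 * t - 3"
    using unit_ABA[OF i nbi] U_D(2)[OF p] T[OF i] by simp
  have Biq: "(B i q)\<^sup>2 = 1" using rows(2) Aip Apq by auto
  \<comment> \<open>the only neighbours of \<open>p\<close> are \<open>i\<close> and \<open>q\<close>, so a unit that shares a neighbour with \<open>i\<close> shares \<open>q\<close>\<close>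
  have star: "j \<in> nb q" if j: "j \<in> U" "j \<noteq> q" for j
  proof -
    have "q \<in> nb j"
    proof (cases "j = i \<or> j = p")
      case True
      then show ?thesis using nbi nbp by auto
    next
      case False
      then have "p \<notin> nb j" using nbp nb_sym[of j p] V j U_subset by auto
      then show ?thesis using units_common_nb[OF i j(1) _ nbi] False by auto
    qed
    then show ?thesis using nb_sym[of j q] j V U_subset by auto
  qed
  have split_q: "(\<Sum>k\<in>V. h k) = h q + (\<Sum>k\<in>V - {q}. h k)" for h :: "'a \<Rightarrow> int"
    by (rule sum.remove[OF fin V(3)])
  have card_rest: "card (V - {q}) = 2 * l" using card_V fin V(3) by simp
  have q_nb: "nb q \<subseteq> V - {q}" using not_in_nb_self[of q] by (auto simp: nb_def)
  have deg_q: "int (card (nb q)) = 2 * int l + 2 * t - 2" using B_diag[of q] Bqq by simp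
  show ?thesis
  proof (cases "t = 1")
    case True
    have "(\<Sum>k\<in>V - {q}. B k k - (B i k)\<^sup>2) = 0"
      using sum_schur_diag[OF i] split_q[of "\<lambda>k. B k k - (B i k)\<^sup>2"] True Bqq Biq T[OF i] by simp
    moreover have "\<forall>k\<in>V - {q}. B k k - (B i k)\<^sup>2 \<ge> 0" using schur_nonneg[OF U_D[OF i]] by auto
    ultimately have eq: "B k k - (B i k)\<^sup>2 = 0" if "k \<in> V - {q}" for k
      using that fin by (subst (asm) sum_nonneg_eq_0_iff) auto
    have "(\<Sum>k\<in>V - {q}. (B i k)\<^sup>2 - 1) = 0"
      using sum_row_sq[OF i] split_q[of "\<lambda>k. (B i k)\<^sup>2"] True Biq T[OF i] card_rest
      by (simp add: sum_subtractf)
    moreover have "\<forall>k\<in>V - {q}. (B i k)\<^sup>2 - 1 \<ge> 0" using eq B_diag_ge_1 by force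
    ultimately have "(B i k)\<^sup>2 - 1 = 0" if "k \<in> V - {q}" for k
      using that fin by (subst (asm) sum_nonneg_eq_0_iff) auto
    then have units: "k \<in> U" if "k \<in> V - {q}" for k
      using eq[OF that] that by (auto simp: U_def)
    have "friendship_at q"
      unfolding friendship_at_def
    proof (intro conjI ballI V(3))
      fix k assume k: "k \<in> V - {q}"
      have "q \<in> nb k" using star[OF units[OF k]] k nb_sym[of k q] V by auto
      then obtain m where m: "nb k = {q, m}" "q \<noteq> m" by (rule unit_nb_other[OF units[OF k]])
      moreover have "m \<noteq> k" "m \<in> V" using m not_in_nb_self[of k] by (auto simp: nb_def)
      moreover have "A k q * A k m * A q m = 1"
        using T_unit[OF m] T[OF units[OF k]] True by simp
      ultimately show "\<exists>m\<in>V - {q}. m \<noteq> k \<and> nb k = {q, m} \<and> A k q * A k m * A q m = 1" by auto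
    qed
    then show ?thesis ..
  next
    case False
    with t have t: "t = -1" by simp
    let ?U = "U - {q}" and ?W = "V - {q} - U"
    have sub: "?U \<subseteq> nb q" using star by auto
    have disj: "V - {q} = ?U \<union> ?W" "?U \<inter> ?W = {}" using U_subset by auto
    have sum_split: "(\<Sum>k\<in>V - {q}. h k) = (\<Sum>k\<in>?U. h k) + (\<Sum>k\<in>?W. h k)" for h :: "'a \<Rightarrow> int"
      using fin by (subst disj(1), subst sum.union_disjoint) auto
    have "(\<Sum>k\<in>V - {q}. B k k) = 2 * int l + 4"
      using split_q[of "\<lambda>k. B k k"] tr_B Bqq t by simp
    moreover have "(\<Sum>k\<in>?U. B k k) = int (card ?U)" by (simp add: U_D)
    moreover have "(\<Sum>k\<in>?W. B k k) \<ge> (\<Sum>k\<in>?W. 2)"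
      using nonunit by (intro sum_mono) auto
    moreover have cards: "int (card ?U) + int (card ?W) = 2 * int l"
      using sum_split[of "\<lambda>_. 1"] card_rest by simp
    ultimately have "int (card ?U) \<ge> 2 * int l - 4"
      using sum_split[of "\<lambda>k. B k k"] by simp
    then have "card (nb q) \<le> card ?U" using deg_q t by simp
    then have nbq: "nb q = ?U" using sub card_seteq[OF finite_nb sub] by simp
    then have W4: "int (card ?W) = 4" using cards deg_q t by simp
    have "?W \<noteq> {}"
    proof
      assume "?W = {}"
      then have "card ?W = 0" by (simp only: card.empty)
      then show False using W4 by linarith
    qed
    moreover have "insert q ?U = V"
    proof (rule connected)
      fix u v assume uv: "u \<in> insert q ?U" "v \<in> V" "A u v \<noteq> 0"
      show "v \<in> insert q ?U"
      proof (cases "u = q")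
        case True
        then have "v \<in> nb q" using uv by (simp add: nb_def)
        then show ?thesis using nbq by simp
      next
        case False
        then have u: "u \<in> U" "u \<noteq> q" using uv by auto
        have "q \<in> nb u" using star[OF u] nb_sym[of u q] V u U_subset by auto
        then obtain m where m: "nb u = {q, m}" "q \<noteq> m" by (rule unit_nb_other[OF u(1)])
        have "A q m \<noteq> 0" using T_unit[OF m] T[OF u(1)] t by auto
        moreover have "m \<in> V" using m by (auto simp: nb_def)
        ultimately have "m \<in> ?U" using nbq by (auto simp: nb_def)
        moreover have "v \<in> nb u" using uv by (simp add: nb_def)
        ultimately show ?thesis using m by auto
      qed
    qed (use V U_subset in auto)
    ultimately show ?thesis by auto
  qed
qed

end

section \<open>No two adjacent vertices of degree two\<close>

context friendship_like
begin

context
  assumes no_adjacent_units: "\<And>i j. i \<in> U \<Longrightarrow> j \<in> U \<Longrightarrow> j \<notin> nb i"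
begin

lemma unit_nb_nonunit:
  assumes "i \<in> U"
  shows "nb i \<subseteq> V - U"
  using no_adjacent_units[OF assms] by (auto simp: nb_def)

lemma card_nonunits: "int (card (V - U)) = 2 * int l + 1 - int (card U)"
  using card_Diff_subset[OF finite_U U_subset] card_mono[OF fin U_subset] card_V by simp

text \<open>A common neighbour \<open>p\<close> of all units has degree at least \<open>card U\<close>, which uses up
\<open>unit_excess\<close>: its degree equals \<open>card U\<close>, so its neighbours are the units only and
there are no triangles at units, and all other nonunits have degree three. The vectors of \<open>p\<close> and
of the other neighbours \<open>q j\<close> are then orthogonal to those of the units, and their total length
against \<open>unit_ABA\<close> leaves \<open>(card U - 1) (card U - 3) \<le> 0\<close>.\<close>

lemma star_at_common_nb:
  assumes i: "i \<in> U" and p: "\<And>j. j \<in> U \<Longrightarrow> p \<in> nb j"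
  shows "card U = 3"
proof -
  have pV: "p \<in> V" "p \<notin> U" using unit_nb_nonunit[OF i] p[OF i] by auto
  have U_nb: "U \<subseteq> nb p" using p nb_sym pV U_subset by blast
  then have Bpp_ge: "B p p \<ge> int (card U) - 1"
    using card_mono[OF finite_nb U_nb] B_diag[of p] by simp
  have split_p: "(\<Sum>k\<in>V - U. h k) = h p + (\<Sum>k\<in>V - U - {p}. h k)" for h :: "'a \<Rightarrow> int"
    using fin pV by (intro sum.remove) auto
  have nonneg: "\<forall>k\<in>V - U - {p}. B k k - 2 \<ge> 0" using nonunit by force
  then have "(\<Sum>k\<in>V - U - {p}. B k k - 2) \<ge> 0" by (intro sum_nonneg) auto
  then have Bpp: "B p p = int (card U) - 1" and rest: "(\<Sum>k\<in>V - U - {p}. B k k - 2) = 0"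
    using Bpp_ge unit_excess split_p[of "\<lambda>k. B k k - 2"] by auto
  have two: "B k k = 2" if "k \<in> V - U - {p}" for k
    using rest nonneg that fin by (subst (asm) sum_nonneg_eq_0_iff) auto
  have "card (nb p) = card U" using Bpp B_diag[of p] by simp
  then have nbp: "nb p = U" using card_subset_eq[OF finite_nb U_nb] by simp
  have "\<forall>j\<in>U. \<exists>q. nb j = {p, q} \<and> p \<noteq> q"
  proof
    fix j assume j: "j \<in> U"
    obtain q where "nb j = {p, q}" "p \<noteq> q" by (rule unit_nb_other[OF j p[OF j]])
    then show "\<exists>q. nb j = {p, q} \<and> p \<noteq> q" by auto
  qed
  then obtain q where q: "\<And>j. j \<in> U \<Longrightarrow> nb j = {p, q j} \<and> p \<noteq> q j" by metis
  have qR: "q j \<in> V - U - {p}" if "j \<in> U" for j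
    using q[OF that] unit_nb_nonunit[OF that] by auto
  have Apq: "A p (q j) = 0" if "j \<in> U" for j
  proof -
    have "q j \<notin> nb p" using qR[OF that] nbp by auto
    then show ?thesis using qR[OF that] by (simp add: nb_def)
  qed
  have Ti: "T i = 0" using T_unit[of i p "q i"] q[OF i] Apq[OF i] by simp
  have Bp0: "B j p = 0" "B j (q j) = 0" if "j \<in> U" for j
    using unit_row_nb[of j p "q j"] q[OF that] Apq[OF that] by auto
  have q_inj: "inj_on q U"
  proof (rule inj_onI, rule ccontr)
    fix j k assume jk: "j \<in> U" "k \<in> U" "q j = q k" "j \<noteq> k"
    have "p \<in> nb k \<longleftrightarrow> q j \<notin> nb k"
      using units_common_nb[OF jk(1,2,4)] q[OF jk(1)] by auto
    then show False using q[OF jk(2)] jk(3) by auto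
  qed
  let ?s = "\<lambda>k. B k k - (B i k)\<^sup>2"
  have s_nonneg: "?s k \<ge> 0" if "k \<in> V" for k using schur_nonneg[OF U_D[OF i] that] .
  have "?s (q j) = 2" if "j \<in> U" for j
    using two[OF qR[OF that]] units_row_sq[OF i that, of "q j"] Bp0(2)[OF that] qR[OF that] by simp
  then have "(\<Sum>k\<in>q ` U. ?s k) = 2 * int (card U)"
    by (subst sum.reindex[OF q_inj]) simp
  moreover have "?s p = int (card U) - 1" using Bp0(1)[OF i] Bpp by simp
  moreover have "(\<Sum>k\<in>insert p (q ` U). ?s k) \<le> (\<Sum>k\<in>V. ?s k)"
    using pV qR s_nonneg fin by (intro sum_mono2) auto
  moreover have "p \<notin> q ` U" using qR by auto
  ultimately have big: "3 * int (card U) - 1 \<le> 2 * int l"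
    using sum_schur_diag[OF i] Ti by simp
  \<comment> \<open>all vectors in the complement of \<open>i\<close> are parallel, so the inner product of two of them is determined up to sign by their lengths\<close>
  have sq: "(B p (q i))\<^sup>2 = 2 * (int (card U) - 1)"
    using schur_sq[OF U_D[OF i] pV(1), of "q i"] Bp0[OF i] Bpp two[OF qR[OF i]] qR[OF i] by simp
  have "int (card U) + 1 + 2 * (A i p * A i (q i) * B p (q i)) = 2 * int l"
    using unit_ABA[of i p "q i"] i q[OF i] Bpp two[OF qR[OF i]] Ti by simp
  then have "A i p * A i (q i) * B p (q i) \<ge> int (card U) - 1" using big by simp
  moreover have "(A i p * A i (q i) * B p (q i))\<^sup>2 = (B p (q i))\<^sup>2"
    using unit_nb_A[of i p "q i"] q[OF i] by auto
  ultimately have "(int (card U) - 1)\<^sup>2 \<le> 2 * (int (card U) - 1)"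
    using sq card_U_ge_3 power_mono[of "int (card U) - 1" "A i p * A i (q i) * B p (q i)" 2] by simp
  then have "(int (card U) - 1) * (int (card U) - 3) \<le> 0"
    by (simp add: power2_eq_square algebra_simps)
  then have "int (card U) \<le> 3" using card_U_ge_3 by (simp add: mult_le_0_iff)
  then show ?thesis using card_U_ge_3 by simp
qed

lemma two_units:
  assumes "i \<in> U"
  obtains j p q r where "j \<in> U" "j \<noteq> i" "nb i = {p, q}" "p \<noteq> q" "nb j = {p, r}" "p \<noteq> r" "q \<noteq> r"
proof -
  have "U \<noteq> {i}" using card_U_ge_3 by auto
  then obtain j where j: "j \<in> U" "j \<noteq> i" using assms by auto
  obtain a b where ab: "nb i = {a, b}" "a \<noteq> b" by (rule unit_nb[OF assms])
  have xor: "a \<in> nb j \<longleftrightarrow> b \<notin> nb j" using units_common_nb[OF assms j(1) _ ab] j(2) by auto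
  show ?thesis
  proof (cases "a \<in> nb j")
    case True
    obtain r where "nb j = {a, r}" "a \<noteq> r" by (rule unit_nb_other[OF j(1) True])
    then show ?thesis using that[OF j ab] xor by auto
  next
    case False
    then have b: "b \<in> nb j" using xor by simp
    obtain r where "nb j = {b, r}" "b \<noteq> r" by (rule unit_nb_other[OF j(1) b])
    then show ?thesis using that[OF j, of b a r] ab False by (auto simp: insert_commute)
  qed
qed

text \<open>Pairs of neighbours of units meet pairwise in one vertex. Three such pairs without a common vertex form a
triangle \<open>{p, q}, {p, r}, {q, r}\<close>, and no fourth pair meets each of them in exactly one vertex;
otherwise all pairs share a vertex and \<open>star_at_common_nb\<close> applies.\<close>

lemma card_U_eq_3: "card U = 3"
proof (rule ccontr)
  assume not3: "card U \<noteq> 3"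
  obtain i where i: "i \<in> U" using card_U_ge_3 by fastforce
  obtain j p q r where j: "j \<in> U" "j \<noteq> i" and nbi: "nb i = {p, q}" "p \<noteq> q"
    and nbj: "nb j = {p, r}" "p \<noteq> r" and qr: "q \<noteq> r"
    by (rule two_units[OF i])
  have "\<exists>k\<in>U. p \<notin> nb k" using star_at_common_nb[OF i, of p] not3 by auto
  then obtain k where k: "k \<in> U" "p \<notin> nb k" by auto
  then have ki: "k \<noteq> i" "k \<noteq> j" using nbi nbj by auto
  have "q \<in> nb k" "r \<in> nb k"
    using units_common_nb[OF i k(1) _ nbi] units_common_nb[OF j(1) k(1) _ nbj] ki k(2) by auto
  moreover obtain c d where "nb k = {c, d}" "c \<noteq> d" by (rule unit_nb[OF k(1)])
  ultimately have nbk: "nb k = {q, r}" using qr by auto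
  have "\<not> U \<subseteq> {i, j, k}"
  proof
    assume "U \<subseteq> {i, j, k}"
    then have "card U \<le> 3" using card_mono[of "{i, j, k}" U] by (simp add: card_insert_if split: if_splits)
    then show False using card_U_ge_3 not3 by simp
  qed
  then obtain m where "m \<in> U" "m \<noteq> i" "m \<noteq> j" "m \<noteq> k" by auto
  then show False
    using units_common_nb[OF i _ _ nbi, of m] units_common_nb[OF j(1) _ _ nbj, of m]
      units_common_nb[OF k(1) _ _ nbk qr, of m] by auto
qed

text \<open>With exactly three units, all other vertices have degree three. A triangle at a unit would give \<open>p\<close>
four neighbours. Otherwise the vectors of \<open>p, q, r\<close> are orthogonal to that of \<open>i\<close>, and
\<open>unit_ABA\<close> forces \<open>l = 4\<close>. Then \<open>sum_row_sq\<close> requires the six nonunits to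
have squared inner products with \<open>i\<close> of total 4, although only three of them contribute, each at
most 1.\<close>

lemma no_adjacent_units_False: False
proof -
  obtain i where i: "i \<in> U" using card_U_ge_3 by fastforce
  obtain j p q r where j: "j \<in> U" "j \<noteq> i" and nbi: "nb i = {p, q}" "p \<noteq> q"
    and nbj: "nb j = {p, r}" "p \<noteq> r" and qr: "q \<noteq> r"
    by (rule two_units[OF i])
  have R: "p \<in> V - U" "q \<in> V - U" "r \<in> V - U"
    using unit_nb_nonunit[OF i] unit_nb_nonunit[OF j(1)] nbi nbj by auto
  have two: "B k k = 2" if "k \<in> V - U" for k
  proof -
    have "\<forall>k\<in>V - U. B k k - 2 \<ge> 0" using nonunit by force
    moreover have "(\<Sum>k\<in>V - U. B k k - 2) = 0" using unit_excess card_U_eq_3 by simp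
    ultimately have "\<forall>k\<in>V - U. B k k - 2 = 0"
      using fin by (subst sum_nonneg_eq_0_iff[symmetric]) auto
    then show ?thesis using that by auto
  qed
  show False
  proof (cases "A p q = 0")
    case False
    then have "T j \<noteq> 0"
      using T_unit[OF nbi] T_const[OF i j(1)] unit_nb_A[OF nbi(1)] by auto
    then have "A p r \<noteq> 0" using T_unit[OF nbj] by auto
    then have "{i, j, q, r} \<subseteq> nb p"
      using False R i j nbi nbj U_subset nb_sym[of i p] nb_sym[of j p] by (auto simp: nb_def)
    moreover have "card {i, j, q, r} = 4" using R i j qr by (auto simp: card_insert_if)
    ultimately have "card (nb p) \<ge> 4" using card_mono[OF finite_nb] by metis
    then show False using two[OF R(1)] B_diag[of p] by simp
  next
    case True
    then have Ti: "T i = 0" using T_unit[OF nbi] by simp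
    then have "T j = 0" using T_const[OF i j(1)] by simp
    then have Apr: "A p r = 0" using T_unit[OF nbj] unit_nb_A[OF nbj(1)] by auto
    have B0: "B i p = 0" "B i q = 0" using unit_row_nb[OF nbi] True by auto
    have "B j r = 0" using unit_row_nb[OF nbj] Apr by auto
    then have B0r: "B i r = 0" using units_row_sq[OF i j(1), of r] R by simp
    have "(B p q)\<^sup>2 = 4"
      using schur_sq[OF U_D[OF i], of p q] R B0 two by simp
    then have "(B p q - 2) * (B p q + 2) = 0" by (simp add: power2_eq_square algebra_simps)
    then have "B p q \<in> {-2, 2}" by auto
    moreover have "4 + 2 * (A i p * A i q * B p q) = 2 * int l"
      using unit_ABA[OF i nbi] two R Ti by simp
    ultimately have l: "l = 4" using unit_nb_A[OF nbi(1)] l_ge_1 by auto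
    have card_R: "card (V - U - {p, q, r}) = 3"
    proof -
      have "card (V - U) = 6" using card_nonunits card_U_eq_3 l by simp
      moreover have "card {p, q, r} = 3" using nbi nbj qr by auto
      ultimately show ?thesis using R by (subst card_Diff_subset) auto
    qed
    have "(B i k)\<^sup>2 \<le> 1" if "k \<in> V - U" for k
    proof -
      have "(B i k)\<^sup>2 \<le> 2" using schur_nonneg[OF U_D[OF i], of k] two[OF that] that by simp
      then have "\<bar>B i k\<bar> < 2" using abs_le_square_iff[of 2 "B i k"] by simp
      then show ?thesis by (simp add: abs_square_le_1)
    qed
    then have "(\<Sum>k\<in>V - U - {p, q, r}. (B i k)\<^sup>2) \<le> (\<Sum>k\<in>V - U - {p, q, r}. 1)"
      by (intro sum_mono) auto
    then have le3: "(\<Sum>k\<in>V - U - {p, q, r}. (B i k)\<^sup>2) \<le> 3" using card_R by simp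
    have "(\<Sum>k\<in>V - U. (B i k)\<^sup>2) = (\<Sum>k\<in>V - U - {p, q, r}. (B i k)\<^sup>2)"
      using B0 B0r fin by (intro sum.mono_neutral_right) auto
    moreover have "(\<Sum>k\<in>U. (B i k)\<^sup>2) = 3"
    proof -
      have "(\<Sum>k\<in>U. (B i k)\<^sup>2) = (\<Sum>k\<in>U. 1)"
        using units_row(1)[OF i] by (intro sum.cong refl) force
      then show ?thesis using card_U_eq_3 by simp
    qed
    moreover have "(\<Sum>k\<in>V. (B i k)\<^sup>2) = (\<Sum>k\<in>V - U. (B i k)\<^sup>2) + (\<Sum>k\<in>U. (B i k)\<^sup>2)"
      using sum.subset_diff[OF U_subset fin] .
    ultimately show False using sum_row_sq[OF i] Ti l le3 by simp
  qed
qed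

end

lemma ex_friendship_at: "\<exists>q. friendship_at q"
  using adjacent_units_imp_friendship no_adjacent_units_False by blast

end

section \<open>Recognising the friendship graph\<close>

text \<open>A fixed-point-free involution is the same as a perfect matching, hence it is conjugate to
\<open>partner\<close>.\<close>

lemma involution_matching:
  assumes "finite W" "card W = 2 * l" "\<And>k. k \<in> W \<Longrightarrow> h k \<in> W \<and> h k \<noteq> k \<and> h (h k) = k"
  shows "\<exists>f. bij_betw f W {1..2 * l} \<and> (\<forall>k\<in>W. f (h k) = partner (f k))"
  using assms
proof (induction l arbitrary: W)
  case 0
  then show ?case by (auto simp: bij_betw_def)
next
  case (Suc l)
  then have "W \<noteq> {}" by auto
  then obtain k where k: "k \<in> W" by auto
  let ?W = "W - {k, h k}"
  have hk: "h k \<in> W" "h k \<noteq> k" "h (h k) = k" using Suc.prems(3)[OF k] by auto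
  have "card ?W = 2 * l"
    using Suc.prems(1,2) k hk by (subst card_Diff_subset) (auto simp: card_insert_if)
  moreover have "h x \<in> ?W \<and> h x \<noteq> x \<and> h (h x) = x" if "x \<in> ?W" for x
  proof -
    have x: "h x \<in> W" "h x \<noteq> x" "h (h x) = x" using Suc.prems(3)[of x] that by auto
    have "h x \<noteq> k" "h x \<noteq> h k" using x(3) hk(3) that by auto
    then show ?thesis using x by auto
  qed
  ultimately obtain f where f: "bij_betw f ?W {1..2 * l}" "\<forall>x\<in>?W. f (h x) = partner (f x)"
    using Suc.IH[of ?W] Suc.prems(1) by auto
  define g where "g = (\<lambda>x. if x = k then 2 * l + 1 else if x = h k then 2 * l + 2 else f x)"
  have "bij_betw g ?W {1..2 * l}"
    using f(1) by (rule bij_betw_cong[THEN iffD1, rotated]) (auto simp: g_def)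
  moreover have "bij_betw g {k, h k} {2 * l + 1, 2 * l + 2}"
    using hk by (auto simp: bij_betw_def g_def)
  ultimately have "bij_betw g (?W \<union> {k, h k}) ({1..2 * l} \<union> {2 * l + 1, 2 * l + 2})"
    by (rule bij_betw_combine) auto
  moreover have "?W \<union> {k, h k} = W" using k hk by auto
  moreover have "{1..2 * l} \<union> {2 * l + 1, 2 * l + 2} = {1..2 * Suc l}" by auto
  ultimately have "bij_betw g W {1..2 * Suc l}" by simp
  moreover have "g (h x) = partner (g x)" if "x \<in> W" for x
  proof (cases "x \<in> {k, h k}")
    case True
    then show ?thesis using hk by (auto simp: g_def partner_def)
  next
    case False
    then have "h x \<noteq> k" "h x \<noteq> h k" using Suc.prems(3)[OF that] hk(3) by auto
    then show ?thesis using False f(2) that by (auto simp: g_def)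
  qed
  ultimately show ?case by blast
qed

lemma friendship_like_cospectral:
  fixes G :: "'a sgraph"
  assumes l: "l \<ge> 1" and G: "signed_graph G" and cos: "cospectral G (friendship_graph l)"
    and con: "\<not> disconnected G"
  shows "friendship_like (verts G) (sadj G)
    (\<lambda>u v. (\<Sum>w\<in>verts G. sadj G u w * sadj G w v) - of_bool (u = v)) l"
proof
  interpret signed_graph G by fact
  show "finite (verts G)" by (rule finite_verts)
  show "sadj G u v \<in> {-1, 0, 1}" for u v
    using esign_edge[of "{u, v}"] by (auto simp: sadj_def)
  show "sadj G u v = sadj G v u" for u v by (rule sadj_sym)
  show "sadj G u u = 0" for u
    using card_edge[of "{u, u}"] by (auto simp: sadj_def)
  show "S = verts G" if S: "S \<subseteq> verts G" "S \<noteq> {}"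
    and closed: "\<And>u v. u \<in> S \<Longrightarrow> v \<in> verts G \<Longrightarrow> sadj G u v \<noteq> 0 \<Longrightarrow> v \<in> S" for S
  proof (rule ccontr)
    assume "S \<noteq> verts G"
    then obtain u v where uv: "u \<in> S" "v \<in> verts G" "v \<notin> S" using S by auto
    have "y \<in> S" if "(x, y) \<in> {(x, y). {x, y} \<in> edges G}\<^sup>*" "x \<in> S" for x y
      using that
    proof (induction rule: rtrancl_induct)
      case (step y z)
      then have e: "{y, z} \<in> edges G" "y \<in> S" by auto
      then have "z \<in> verts G" using edges_subset by auto
      moreover have "sadj G y z \<noteq> 0" using e(1) esign_edge[OF e(1)] by (auto simp: sadj_def)
      ultimately show ?case using closed e(2) by auto
    qed
    then have "(u, v) \<notin> {(x, y). {x, y} \<in> edges G}\<^sup>*" using uv by auto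
    then show False using con uv S(1) unfolding disconnected_def by auto
  qed
qed (use l cospectral_friendship_walks[OF l G cos] in \<open>simp_all\<close>)

text \<open>The map that sends a vertex to its neighbour different from the centre is a fixed-point-free involution;
numbering its orbits yields the isomorphism of underlying graphs.\<close>

lemma (in friendship_like) friendship_coordinates:
  "\<exists>q\<in>V. \<exists>f. bij_betw f V {0..2 * l} \<and>
    (\<forall>u\<in>V. \<forall>v\<in>V. A u v \<noteq> 0 \<longleftrightarrow> {f u, f v} \<in> edges (friendship_graph l)) \<and>
    (\<forall>u\<in>V - {q}. \<forall>v\<in>V - {q}. A u v \<noteq> 0 \<longrightarrow> A u q * A u v * A q v = 1)"
proof -
  obtain q where "friendship_at q" using ex_friendship_at by auto
  then have q: "q \<in> V" and ex: "\<forall>k\<in>V - {q}. \<exists>m. m \<in> V - {q} \<and> m \<noteq> k \<and> nb k = {q, m} \<and> A k q * A k m * A q m = 1"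
    by (auto simp: friendship_at_def)
  obtain h where h: "\<forall>k\<in>V - {q}. h k \<in> V - {q} \<and> h k \<noteq> k \<and> nb k = {q, h k} \<and> A k q * A k (h k) * A q (h k) = 1"
    using bchoice[OF ex] by auto
  let ?W = "V - {q}"
  have "h (h k) = k" if "k \<in> ?W" for k
  proof -
    have "h k \<in> nb k" "k \<in> V" "h k \<in> ?W" using h that by auto
    then have "k \<in> nb (h k)" using nb_sym[of k "h k"] by auto
    moreover have "nb (h k) = {q, h (h k)}" using h \<open>h k \<in> ?W\<close> by auto
    ultimately show ?thesis using that by auto
  qed
  then have h': "h k \<in> ?W \<and> h k \<noteq> k \<and> h (h k) = k" if "k \<in> ?W" for k
    using h that by auto
  have cardW: "card ?W = 2 * l" using card_V fin q by simp
  obtain f0 where f0: "bij_betw f0 ?W {1..2 * l}" "\<forall>k\<in>?W. f0 (h k) = partner (f0 k)"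
    using involution_matching[OF _ cardW h'] fin by auto
  define f where "f = f0(q := 0)"
  have f_eq: "f k = f0 k" if "k \<in> ?W" for k using that by (auto simp: f_def)
  have "bij_betw f ?W {1..2 * l}"
    using f0(1) by (rule bij_betw_cong[THEN iffD1, rotated]) (simp add: f_eq)
  moreover have "bij_betw f {q} {0}" by (auto simp: f_def bij_betw_def)
  ultimately have "bij_betw f (?W \<union> {q}) ({1..2 * l} \<union> {0})"
    by (rule bij_betw_combine) auto
  moreover have "?W \<union> {q} = V" "{1..2 * l} \<union> {0} = {0..2 * l}" using q by auto
  ultimately have bij: "bij_betw f V {0..2 * l}" by simp
  have range: "f k \<le> 2 * l" if "k \<in> V" for k
    using bij_betw_apply[OF bij that] by simp
  have f0_iff: "f k = 0 \<longleftrightarrow> k = q" if "k \<in> V" for k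
    using bij_betw_apply[OF f0(1), of k] f_eq[of k] that by (cases "k = q") (auto simp: f_def)
  have inj: "f u = f v \<longleftrightarrow> u = v" if "u \<in> V" "v \<in> V" for u v
    using bij that by (auto simp: bij_betw_def inj_on_def)
  have A_iff: "A u v \<noteq> 0 \<longleftrightarrow> v = q \<or> v = h u" if "u \<in> ?W" "v \<in> V" for u v
  proof -
    have "A u v \<noteq> 0 \<longleftrightarrow> v \<in> nb u" using that by (simp add: nb_def)
    then show ?thesis using h that by auto
  qed
  have "A u v \<noteq> 0 \<longleftrightarrow> {f u, f v} \<in> edges (friendship_graph l)" if uv: "u \<in> V" "v \<in> V" for u v
  proof -
    consider "u = v" | "u = q" "v \<in> ?W" | "v = q" "u \<in> ?W" | "u \<in> ?W" "v \<in> ?W" "u \<noteq> v"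
      using uv by auto
    then show ?thesis
    proof cases
      case 1
      then show ?thesis
        using edge_friendship_graph_iff[of "f v" "f v" l] by (simp add: A_diag)
    next
      case 2
      then have "A u v \<noteq> 0" using A_iff[of v u] uv A_sym[of u v] by simp
      then show ?thesis using 2 range uv inj[OF uv] f0_iff[OF uv(1)]
        by (auto simp: edge_friendship_graph_iff)
    next
      case 3
      then have "A u v \<noteq> 0" using A_iff[of u v] uv by simp
      then show ?thesis using 3 range uv inj[OF uv] f0_iff[OF uv(2)]
        by (auto simp: edge_friendship_graph_iff)
    next
      case 4
      have hu: "h u \<in> ?W" using h 4(1) by auto
      have "f (h u) = partner (f u)" using f0(2) f_eq hu 4(1) by simp
      then have "{f u, f v} \<in> edges (friendship_graph l) \<longleftrightarrow> f v = f (h u)"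
        using range uv inj[OF uv] f0_iff[OF uv(1)] f0_iff[OF uv(2)] 4
        by (auto simp: edge_friendship_graph_iff)
      also have "\<dots> \<longleftrightarrow> v = h u" using inj[of v "h u"] hu uv by auto
      also have "\<dots> \<longleftrightarrow> A u v \<noteq> 0" using A_iff[OF 4(1) uv(2)] 4(2) by auto
      finally show ?thesis ..
    qed
  qed
  moreover have "A u q * A u v * A q v = 1" if "u \<in> ?W" "v \<in> ?W" "A u v \<noteq> 0" for u v
  proof -
    have "v = h u" using A_iff[of u v] that by auto
    then show ?thesis using h that(1) by auto
  qed
  ultimately show ?thesis using q bij by (intro bexI[of _ q] exI[of _ f]) auto
qed

theorem corollary5p2:
  fixes l :: nat and G :: "'a sgraph"
  assumes "l \<ge> 1"
    and "signed_graph G"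
    and "cospectral G (friendship_graph l)"
  shows "switching_isomorphic G (friendship_graph l) \<or> disconnected G"
proof (rule disjCI)
  assume con: "\<not> disconnected G"
  interpret signed_graph G by fact
  interpret friendship_like "verts G" "sadj G"
    "\<lambda>u v. (\<Sum>w\<in>verts G. sadj G u w * sadj G w v) - of_bool (u = v)" l
    by (rule friendship_like_cospectral[OF assms con])
  let ?A = "sadj G" and ?F = "friendship_graph l"
  obtain q f where q: "q \<in> verts G" and f: "bij_betw f (verts G) {0..2 * l}"
    and edge: "\<forall>u\<in>verts G. \<forall>v\<in>verts G. ?A u v \<noteq> 0 \<longleftrightarrow> {f u, f v} \<in> edges ?F"
    and tri: "\<forall>u\<in>verts G - {q}. \<forall>v\<in>verts G - {q}. ?A u v \<noteq> 0 \<longrightarrow> ?A u q * ?A u v * ?A q v = 1"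
    using friendship_coordinates by (elim bexE exE conjE)
  define X where "X = {k \<in> verts G. ?A q k = -1}"
  have edge_iff: "{u, v} \<in> edges G \<longleftrightarrow> ?A u v \<noteq> 0" for u v
    using esign_edge[of "{u, v}"] by (auto simp: sadj_def)
  \<comment> \<open>\<open>X\<close> makes the edges at \<open>q\<close> positive; the third edge of a positive triangle follows\<close>
  have sign: "esign (switch X G) {u, v} = 1" if uv: "u \<in> verts G" "v \<in> verts G" "{u, v} \<in> edges G" for u v
  proof -
    have A: "esign G {u, v} = ?A u v" "?A u v \<in> {-1, 1}"
      using uv(3) esign_edge[OF uv(3)] by (auto simp: sadj_def)
    have ne: "u \<noteq> v" using card_edge[OF uv(3)] by auto
    have "{u, v} \<inter> X \<noteq> {} \<and> {u, v} - X \<noteq> {} \<longleftrightarrow> (u \<in> X) \<noteq> (v \<in> X)" by auto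
    then have sw: "esign (switch X G) {u, v} = (if (u \<in> X) \<noteq> (v \<in> X) then - ?A u v else ?A u v)"
      by (simp add: switch_def A(1))
    have qX: "q \<notin> X" by (simp add: X_def A_diag)
    consider "u = q" | "v = q" | "u \<in> verts G - {q}" "v \<in> verts G - {q}" using uv by auto
    then show ?thesis
    proof cases
      case 1
      then show ?thesis unfolding sw using qX A(2) uv by (auto simp: X_def)
    next
      case 2
      then show ?thesis unfolding sw using qX A(2) uv by (auto simp: X_def sadj_sym[of G u])
    next
      case 3
      have "?A u q * ?A u v * ?A q v = 1" using tri[rule_format, OF 3] A(2) by auto
      then show ?thesis unfolding sw using A(2) A_val[of q u] A_val[of q v] uv
        by (auto simp: X_def sadj_sym[of G u q])
    qed
  qed
  have "sgraph_isomorphic (switch X G) ?F"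
    unfolding sgraph_isomorphic_def
  proof (intro exI[of _ f] conjI ballI impI)
    show "bij_betw f (verts (switch X G)) (verts ?F)"
      using f by (simp add: switch_def friendship_graph_def)
    fix u v assume "u \<in> verts (switch X G)" "v \<in> verts (switch X G)"
    then have uv: "u \<in> verts G" "v \<in> verts G" by (simp_all add: switch_def)
    show "{u, v} \<in> edges (switch X G) \<longleftrightarrow> {f u, f v} \<in> edges ?F"
      using edge uv edge_iff by (simp add: switch_def)
    assume "{u, v} \<in> edges (switch X G)"
    then have "{u, v} \<in> edges G" by (simp add: switch_def)
    then show "esign ?F {f u, f v} = esign (switch X G) {u, v}"
      using sign[OF uv] by (simp add: friendship_graph_def)
  qed
  then show "switching_isomorphic G ?F"
    unfolding switching_isomorphic_def by (intro exI[of _ X]) (auto simp: X_def)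
qed

end
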